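(* Let $M$ be a free abelian group of rank $n$. For $i=1,2$, let $P_i$ be a prime congruence on $\mathbb{T}[M]=\mathbb{T}[X_1^{\pm},\dots,X_n^{\pm}]$ and let $H(P_i)_\bullet$ be the corresponding $(\mathbb{R}\times M)$-flag. Then $P_1\subseteq P_2$ if and only if $H(P_2)_\bullet$ is a truncation of $H(P_1)_\bullet$. Furthermore, if the length of the $(\mathbb{R}\times M)$-flag $H(P)_\bullet$ corresponding to a prime congruence $P$ is equal to $l$, then $\operatorname{ht}P=\dim\mathbb{R}(H(P)_l\cap(\mathbb{R}\times M))$, where the linear span is taken in $\mathbb{R}\times M_{\mathbb{R}}$, and $\operatorname{coht}P=l$.
   Context: $\mathbb{T}=\mathbb{R}\cup\{-\infty\}$ is the semifield with $\oplus=\max$, $\odot=+$. Elements of $\mathbb{T}[X_1^{\pm},\dots,X_n^{\pm}]$ are finite formal sums of monomials $rX^u$, $r\in\mathbb{R}$, $u\in M\cong\mathbb{Z}^n$ ($M$ being free on $X_1,\dots,X_n$); $0$ is the multiplicative identity. A congruence on a commutative semiring $S$ is a subsemiring $C\subseteq S\times S$ which is an equivalence relation. It is prime if $(S\times S)\setminus C$ is nonempty and closed under $(a,b)\rtimes(c,d)=(ac+bd,ad+bc)$. The height $\operatorname{ht}P$ (resp. coheight $\operatorname{coht}P$) of a prime congruence $P$ is the supremum of the $l\ge0$ such that there is a chain of prime congruences $P_0\subsetneq\dots\subsetneq P_l=P$ (resp. $P=P_0\subsetneq\dots\subsetneq P_l$). Write $M_{\mathbb{R}}=M\otimes\mathbb{R}$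 and $\mathbb{R}A$ for linear span. An orientation of a linear hyperplane $\{\ell=0\}$ of a real vector space is one of $\{\ell>0\}$, $\{\ell<0\}$. An $(\mathbb{R}\times M)$-flag consists of an integer $l\ge0$ (its length); linear subspaces $\mathbb{R}\times M_{\mathbb{R}}=H_0\supsetneq\dots\supsetneq H_l$ with $H_i$ a hyperplane of $\mathbb{R}(H_{i-1}\cap(\mathbb{R}\times M))$ for $i=1,\dots,l$; and an orientation $H_{i,+}$ of each $H_i$ as such a hyperplane, such that $\mathbb{R}_{\ge0}\times\{0\}\subseteq\bigcup_{i=1}^lH_{i,+}\cup H_l$. A truncation of $\{H_i\}_{i=0}^l$ is a flag $\{H_i\}_{i=0}^{l'}$ with $0\le l'\le l$ (with the same orientations $H_{i,+}$, $i\le l'$). The $(\mathbb{R}\times M)$-flag $H(P)_\bullet$ corresponding to a prime congruence $P$ is the unique one, of length $l$ say, with $$\{(r,u)\in\mathbb{R}\times M\mid (rX^u\oplus0,rX^u)\in P\}=\Big(\bigcup_{i=1}^lH(P)_{i,+}\cup H(P)_l\Big)\cap(\mathbb{R}\times M)$$ (this gives a bijection between prime congruences and $(\mathbb{R}\times M)$-flags). *)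

theory Defs
  imports "HOL-Analysis.Analysis" "HOL-Analysis.Finite_Function_Topology" "HOL-Library.Poly_Mapping" "HOL-Library.Extended_Nat"
begin

section \<open>The tropical semifield\<close>

datatype trop = NegInf | Fin real

instantiation trop :: comm_semiring_1
begin

definition zero_trop :: trop where "0 = NegInf"

definition one_trop :: trop where "1 = Fin 0"

fun plus_trop :: "trop \<Rightarrow> trop \<Rightarrow> trop" where
  "NegInf + y = y"
| "Fin a + NegInf = Fin a"
| "Fin a + Fin b = Fin (max a b)"

fun times_trop :: "trop \<Rightarrow> trop \<Rightarrow> trop" where
  "NegInf * y = NegInf"
| "Fin a * NegInf = NegInf"
| "Fin a * Fin b = Fin (a + b)"

instance
proof
  fix a b c :: trop
  show "a + b + c = a + (b + c)" by (cases a; cases b; cases c) auto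
  show "a + b = b + a" by (cases a; cases b) auto
  show "0 + a = a" by (simp add: zero_trop_def)
  show "a * b * c = a * (b * c)" by (cases a; cases b; cases c) auto
  show "a * b = b * a" by (cases a; cases b) auto
  show "1 * a = a" by (cases a) (auto simp: one_trop_def)
  show "(a + b) * c = a * c + b * c"
    by (cases a; cases b; cases c) (auto simp: max_def)
  show "0 * a = 0" by (simp add: zero_trop_def)
  show "a * 0 = 0" by (cases a) (auto simp: zero_trop_def)
  show "(0::trop) \<noteq> 1" by (simp add: zero_trop_def one_trop_def)
qed

end

section \<open>Tropical Laurent polynomials in n variables\<close>

text \<open>
  The group $M = \mathbb{Z}^n$ is the set of exponent vectors supported on the indices below
  $n$, so that every rank is allowed, including 0. The semiring structure on
  \<^typ>\<open>(nat \<Rightarrow>\<^sub>0 int) \<Rightarrow>\<^sub>0 trop\<close> is the library's: pointwise addition and convolution product.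
\<close>

definition exponents :: "nat \<Rightarrow> (nat \<Rightarrow>\<^sub>0 int) set" where
  "exponents n = {u. Poly_Mapping.keys u \<subseteq> {..<n}}"

definition laurent :: "nat \<Rightarrow> ((nat \<Rightarrow>\<^sub>0 int) \<Rightarrow>\<^sub>0 trop) set" where
  "laurent n = {p. Poly_Mapping.keys p \<subseteq> exponents n}"

definition monomial :: "real \<Rightarrow> (nat \<Rightarrow>\<^sub>0 int) \<Rightarrow> (nat \<Rightarrow>\<^sub>0 int) \<Rightarrow>\<^sub>0 trop" where
  "monomial r u = Poly_Mapping.single u (Fin r)"

lemma laurent_subsemiring:
  "0 \<in> laurent n" "1 \<in> laurent n"
  "p \<in> laurent n \<Longrightarrow> q \<in> laurent n \<Longrightarrow> p + q \<in> laurent n"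
  "p \<in> laurent n \<Longrightarrow> q \<in> laurent n \<Longrightarrow> p * q \<in> laurent n"
proof -
  show "0 \<in> laurent n" "1 \<in> laurent n" by (auto simp: laurent_def exponents_def)
  assume pq: "p \<in> laurent n" "q \<in> laurent n"
  show "p + q \<in> laurent n"
    using pq keys_add[of p q] by (auto simp: laurent_def)
  have "a + b \<in> exponents n" if "a \<in> exponents n" "b \<in> exponents n" for a b
    using that keys_add[of a b] unfolding exponents_def by blast
  then show "p * q \<in> laurent n"
    using pq keys_mult[of p q] unfolding laurent_def by blast
qed

section \<open>Prime congruences, height and coheight\<close>

text \<open>Below, \<open>S\<close> is the carrier of a subsemiring of the ambient commutative semiring.\<close>

definition congruence :: "'a::comm_semiring_1 set \<Rightarrow> ('a \<times> 'a) set \<Rightarrow> bool" where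
  "congruence S C \<longleftrightarrow>
     C \<subseteq> S \<times> S \<and> equiv S C \<and> (0, 0) \<in> C \<and> (1, 1) \<in> C \<and>
     (\<forall>a b c d. (a, b) \<in> C \<longrightarrow> (c, d) \<in> C \<longrightarrow> (a + c, b + d) \<in> C \<and> (a * c, b * d) \<in> C)"

definition prime_congruence :: "'a::comm_semiring_1 set \<Rightarrow> ('a \<times> 'a) set \<Rightarrow> bool" where
  "prime_congruence S C \<longleftrightarrow>
     congruence S C \<and> S \<times> S - C \<noteq> {} \<and>
     (\<forall>a b c d. (a, b) \<in> S \<times> S - C \<longrightarrow> (c, d) \<in> S \<times> S - C \<longrightarrow>
        (a * c + b * d, a * d + b * c) \<in> S \<times> S - C)"

definition prime_chain ::
  "'a::comm_semiring_1 set \<Rightarrow> nat \<Rightarrow> (nat \<Rightarrow> ('a \<times> 'a) set) \<Rightarrow> bool" where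
  "prime_chain S l c \<longleftrightarrow>
     (\<forall>i\<le>l. prime_congruence S (c i)) \<and> (\<forall>i<l. c i \<subset> c (Suc i))"

definition height :: "'a::comm_semiring_1 set \<Rightarrow> ('a \<times> 'a) set \<Rightarrow> enat" where
  "height S P = Sup {enat l |l. \<exists>c. prime_chain S l c \<and> c l = P}"

definition coheight :: "'a::comm_semiring_1 set \<Rightarrow> ('a \<times> 'a) set \<Rightarrow> enat" where
  "coheight S P = Sup {enat l |l. \<exists>c. prime_chain S l c \<and> c 0 = P}"

section \<open>Flags\<close>

type_synonym rvec = "real \<times> (nat \<Rightarrow>\<^sub>0 real)"

text \<open>
  \<open>ambient n\<close> is $\mathbb{R} \times M_{\mathbb{R}}$, and \<open>lattice_points n\<close> is
  the image in it of $\mathbb{R} \times M$.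
\<close>

definition ambient :: "nat \<Rightarrow> rvec set" where
  "ambient n = {(r, x). Poly_Mapping.keys x \<subseteq> {..<n}}"

definition embed :: "real \<times> (nat \<Rightarrow>\<^sub>0 int) \<Rightarrow> rvec" where
  "embed = (\<lambda>(r, u). (r, Poly_Mapping.map real_of_int u))"

definition lattice_points :: "nat \<Rightarrow> rvec set" where
  "lattice_points n = embed ` (UNIV \<times> exponents n)"

text \<open>
  A linear functional on a subspace \<open>V\<close> is represented by a functional on the whole space,
  to which it always extends; only its restriction to \<open>V\<close> matters.
\<close>

definition oriented_hyperplane :: "rvec set \<Rightarrow> rvec set \<Rightarrow> rvec set \<Rightarrow> bool" where
  "oriented_hyperplane V H Hpos \<longleftrightarrow>
     (\<exists>\<phi> :: rvec \<Rightarrow> real. linear \<phi> \<and> (\<exists>x\<in>V. \<phi> x \<noteq> 0) \<and> H = {x\<in>V. \<phi> x = 0} \<and>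
        (Hpos = {x\<in>V. \<phi> x > 0} \<or> Hpos = {x\<in>V. \<phi> x < 0}))"

text \<open>
  A flag of length $l$ is the list of the pairs $(H_i, H_{i,+})$ for $i = 1, \ldots, l$;
  the space $H_0 = \mathbb{R} \times M_{\mathbb{R}}$ is not stored.
\<close>

type_synonym flag = "(rvec set \<times> rvec set) list"

definition flag_space :: "nat \<Rightarrow> flag \<Rightarrow> nat \<Rightarrow> rvec set" where
  "flag_space n F i = (if i = 0 then ambient n else fst (F ! (i - 1)))"

definition flag_pos :: "flag \<Rightarrow> nat \<Rightarrow> rvec set" where
  "flag_pos F i = snd (F ! (i - 1))"

definition flag_cone :: "nat \<Rightarrow> flag \<Rightarrow> rvec set" where
  "flag_cone n F = (\<Union>i\<in>{1..length F}. flag_pos F i) \<union> flag_space n F (length F)"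

definition is_flag :: "nat \<Rightarrow> flag \<Rightarrow> bool" where
  "is_flag n F \<longleftrightarrow>
     (\<forall>i\<in>{1..length F}.
        subspace (flag_space n F i) \<and> flag_space n F i \<subset> flag_space n F (i - 1) \<and>
        oriented_hyperplane (span (flag_space n F (i - 1) \<inter> lattice_points n))
          (flag_space n F i) (flag_pos F i)) \<and>
     {0..} \<times> {0} \<subseteq> flag_cone n F"

definition truncation :: "nat \<Rightarrow> flag \<Rightarrow> flag \<Rightarrow> bool" where
  "truncation n F' F \<longleftrightarrow> is_flag n F' \<and> (\<exists>l'\<le>length F. F' = take l' F)"

definition flag_of :: "nat \<Rightarrow> (((nat \<Rightarrow>\<^sub>0 int) \<Rightarrow>\<^sub>0 trop) \<times> ((nat \<Rightarrow>\<^sub>0 int) \<Rightarrow>\<^sub>0 trop)) set \<Rightarrow> flag" where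
  "flag_of n P = (THE F. is_flag n F \<and>
     embed ` {(r, u). u \<in> exponents n \<and> (monomial r u + 1, monomial r u) \<in> P} =
       flag_cone n F \<inter> lattice_points n)"

end

theory Submission
  imports Defs
begin

text \<open>
  A prime congruence is a total preorder in disguise. Write \<open>p \<le> q\<close> if \<open>p + q\<close> is equivalent to \<open>q\<close>.
  For any \<open>p\<close> and \<open>q\<close> the twisted product of \<open>(p + q, p)\<close> and \<open>(p + q, q)\<close> has equal components, so by
  primality \<open>p + q\<close> is equivalent to \<open>p\<close> or to \<open>q\<close> (\<open>le_total\<close>). Hence each nonzero polynomial is
  equivalent to one of its monomials, and the congruence is determined by the comparisons of monomials.
  As monomials are invertible, all of this is encoded in the cone of monomials \<open>\<ge> 1\<close>. The cones that occur
  are exactly the positive cones of translation-invariant total preorders on \<open>\<real> \<times> M\<close> that extend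
  the order of \<open>\<real>\<close>: given such a cone, call two polynomials equivalent if the same monomials lie below them
  (\<open>prime_congruence_of_cone\<close>). Inclusion of congruences becomes inclusion of cones.

  A flag describes such a cone lexicographically: a lattice point belongs to it if the first functional of
  the flag that does not vanish there is positive, or if all of them vanish. The functionals are forced. If a total cone \<open>K\<close> does not
  contain all lattice points of a space \<open>H\<close>, then there is a linear functional on their span that is nonnegative on
  the part of \<open>K\<close> in \<open>H\<close> (\<open>supporting_functional\<close>), unique up to a positive factor (\<open>proportional_functionals\<close>).
  Existence is Hoelder's theorem for totally preordered groups with an order unit \<open>e\<close>: the function
  \<open>x \<mapsto> sup {p / q | p e \<le> q x}\<close> is additive. Two points need the special shape of \<open>\<real> \<times> M\<close>, namely that an
  order unit exists, and that an additive function is the restriction of a real-linear one. Both follow from the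
  fact that real relations between lattice points come from rational ones, apart from the scalar direction,
  where monotonicity gives linearity. Outside the kernel the sign of the functional decides membership in \<open>K\<close>,
  and on the kernel one continues by recursion; so every cone comes from a flag (\<open>flag_of_total_cone\<close>).
  The same uniqueness shows that, if the cone of one flag contains the cone of another, then the steps of the former
  are the first steps of the latter (\<open>flag_append_if_cone_subset\<close>). This is the first claim.

  So the prime congruences containing \<open>P\<close> correspond to the initial segments of its flag, which gives the
  coheight, and those contained in \<open>P\<close> to the extensions of its flag. Each further step lowers the dimension of
  the span of the lattice points in the last space by at least one, and hyperplanes spanned by lattice points
  lower it by exactly one (\<open>flag_maximal_extension\<close>). This gives the height.
\<close>

section \<open>Positive cones of total preorders\<close>

text \<open>
  The set of elements \<open>\<ge> 0\<close> of a translation-invariant total preorder on the subgroup \<open>G\<close>;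
  elements of \<open>K \<inter> - K\<close> are those equivalent to \<open>0\<close>.
\<close>
definition total_cone :: "'a::ab_group_add set \<Rightarrow> 'a set \<Rightarrow> bool" where
  "total_cone G K \<longleftrightarrow> K \<subseteq> G \<and> (\<forall>x\<in>K. \<forall>y\<in>K. x + y \<in> K) \<and> (\<forall>x\<in>G. x \<in> K \<or> - x \<in> K)"

lemma total_coneD:
  assumes "total_cone G K"
  shows "K \<subseteq> G" "\<And>x y. x \<in> K \<Longrightarrow> y \<in> K \<Longrightarrow> x + y \<in> K" "\<And>x. x \<in> G \<Longrightarrow> x \<in> K \<or> - x \<in> K"
  using assms by (auto simp: total_cone_def)

lemma exponents_group [simp]:
  "0 \<in> exponents n"
  "u \<in> exponents n \<Longrightarrow> v \<in> exponents n \<Longrightarrow> u + v \<in> exponents n"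
  "u \<in> exponents n \<Longrightarrow> - u \<in> exponents n"
  "u \<in> exponents n \<Longrightarrow> v \<in> exponents n \<Longrightarrow> u - v \<in> exponents n"
  using keys_add[of u v] keys_diff[of u v] by (auto simp: exponents_def)

text \<open>
  The pair \<open>(r, u)\<close> stands for the monomial \<open>r X\<^sup>u\<close>, so addition of pairs is
  multiplication of monomials. The second condition says that the preorder extends the order of the scalars.
\<close>
definition monomial_cone :: "nat \<Rightarrow> (real \<times> (nat \<Rightarrow>\<^sub>0 int)) set \<Rightarrow> bool" where
  "monomial_cone n K \<longleftrightarrow> total_cone (UNIV \<times> exponents n) K \<and> {0..} \<times> {0} \<subseteq> K"

lemma monomial_coneD:
  assumes "monomial_cone n K"
  shows "total_cone (UNIV \<times> exponents n) K" "\<And>r. 0 \<le> r \<Longrightarrow> (r, 0) \<in> K"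
    "\<And>r u. (r, u) \<in> K \<Longrightarrow> u \<in> exponents n"
    "\<And>r s u v. (r, u) \<in> K \<Longrightarrow> (s, v) \<in> K \<Longrightarrow> (r + s, u + v) \<in> K"
    "\<And>r u. u \<in> exponents n \<Longrightarrow> (r, u) \<in> K \<or> (- r, - u) \<in> K"
proof -
  show K: "total_cone (UNIV \<times> exponents n) K" and "\<And>r. 0 \<le> r \<Longrightarrow> (r, 0) \<in> K"
    using assms by (auto simp: monomial_cone_def)
  show "u \<in> exponents n" if "(r, u) \<in> K" for r u
    using total_coneD(1)[OF K] that by auto
  show "(r + s, u + v) \<in> K" if "(r, u) \<in> K" "(s, v) \<in> K" for r s u v
    using total_coneD(2)[OF K that] by simp
  show "(r, u) \<in> K \<or> (- r, - u) \<in> K" if "u \<in> exponents n" for r u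
    using total_coneD(3)[OF K, of "(r, u)"] that by simp
qed

section \<open>Tropical Laurent polynomials as sums of monomials\<close>

declare zero_trop_def [simp]

lemma trop_add_eq_NegInf [simp]: "(x + y = NegInf) \<longleftrightarrow> (x = NegInf \<and> y = NegInf)"
  for x y :: trop
  by (cases x; cases y; simp)

lemma trop_add_idem: "x + x = (x::trop)"
  by (cases x) auto

lemma laurent_add_idem: "p + p = (p :: 'a \<Rightarrow>\<^sub>0 trop)"
  by (rule poly_mapping_eqI) (simp add: lookup_add trop_add_idem)

lemma keys_add_trop: "Poly_Mapping.keys (p + q) = Poly_Mapping.keys p \<union> Poly_Mapping.keys (q :: 'a \<Rightarrow>\<^sub>0 trop)"
  by (auto simp: in_keys_iff lookup_add)

lemma monomial_mult: "monomial r u * monomial s v = monomial (r + s) (u + v)"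
  by (simp add: monomial_def mult_single)

lemma monomial_one: "monomial 0 0 = 1"
  by (simp add: monomial_def flip: one_trop_def)

lemma keys_monomial [simp]: "Poly_Mapping.keys (monomial r u) = {u}"
  by (simp add: monomial_def zero_trop_def)

lemma keys_one_trop [simp]: "Poly_Mapping.keys (1 :: (nat \<Rightarrow>\<^sub>0 int) \<Rightarrow>\<^sub>0 trop) = {0}"
  by (simp flip: monomial_one)

lemma monomial_in_laurent [simp]: "monomial r u \<in> laurent n \<longleftrightarrow> u \<in> exponents n"
  by (auto simp: laurent_def)

lemmas laurent_closed [simp] = laurent_subsemiring

text \<open>
  The value outside the support is a dummy: it replaces minus infinity, and only coefficients at
  exponents in the support matter.
\<close>
definition coefficient :: "((nat \<Rightarrow>\<^sub>0 int) \<Rightarrow>\<^sub>0 trop) \<Rightarrow> (nat \<Rightarrow>\<^sub>0 int) \<Rightarrow> real" where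
  "coefficient p u = (case Poly_Mapping.lookup p u of Fin r \<Rightarrow> r | NegInf \<Rightarrow> 0)"

lemma lookup_coefficient: "u \<in> Poly_Mapping.keys p \<Longrightarrow> Poly_Mapping.lookup p u = Fin (coefficient p u)"
  by (auto simp: in_keys_iff coefficient_def split: trop.splits)

lemma coefficient_monomial [simp]: "coefficient (monomial r u) u = r"
  by (simp add: monomial_def coefficient_def)

text \<open>
  Cones, down-sets and the order of a prime congruence all treat \<open>+\<close> as a supremum, so that their properties
  reduce along this rule to single monomials.
\<close>
lemma laurent_induct [consumes 1, case_names zero add]:
  assumes "p \<in> laurent n" and "P 0"
    and step: "\<And>r u q. u \<in> exponents n \<Longrightarrow> q \<in> laurent n \<Longrightarrow> P q \<Longrightarrow> P (monomial r u + q)"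
  shows "P p"
proof -
  define part where "part A = (\<Sum>u\<in>A. monomial (coefficient p u) u)" for A
  have "part A \<in> laurent n \<and> P (part A)" if "A \<subseteq> Poly_Mapping.keys p" for A
    using finite_subset[OF that finite_keys] that
  proof (induction A)
    case (insert u A)
    then show ?case
      using assms(1) step[of u "part A" "coefficient p u"]
      by (auto simp: part_def laurent_def keys_add_trop)
  qed (use assms(2) in \<open>auto simp: part_def\<close>)
  moreover have "part (Poly_Mapping.keys p) = p"
  proof (rule poly_mapping_eqI)
    fix u
    have *: "Poly_Mapping.lookup (monomial r v) u = (if u = v then Fin r else 0)" for r v
      by (simp add: monomial_def lookup_single when_def)
    have "Poly_Mapping.lookup (part (Poly_Mapping.keys p)) u =
        (\<Sum>v\<in>Poly_Mapping.keys p. if u = v then Fin (coefficient p v) else 0)"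
      by (simp add: part_def lookup_sum *)
    also have "\<dots> = Poly_Mapping.lookup p u"
      using lookup_coefficient[of u p] by (auto simp: sum.delta' in_keys_iff)
    finally show "Poly_Mapping.lookup (part (Poly_Mapping.keys p)) u = Poly_Mapping.lookup p u" .
  qed
  ultimately show ?thesis by (metis order_refl)
qed

section \<open>The prime congruence of a cone of monomials\<close>

text \<open>
  The monomials that lie below some monomial of \<open>p\<close> in the preorder with positive cone \<open>K\<close>. Passing
  to this set forgets everything about \<open>p\<close> except its leading behaviour; the next lemmas say that it
  turns sums into unions and products into Minkowski sums, so that its kernel is a congruence.
\<close>
definition downset :: "(real \<times> (nat \<Rightarrow>\<^sub>0 int)) set \<Rightarrow> ((nat \<Rightarrow>\<^sub>0 int) \<Rightarrow>\<^sub>0 trop) \<Rightarrow> (real \<times> (nat \<Rightarrow>\<^sub>0 int)) set" where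
  "downset K p = {(s, v). \<exists>u\<in>Poly_Mapping.keys p. (coefficient p u - s, u - v) \<in> K}"

lemma downset_zero [simp]: "downset K 0 = {}"
  by (simp add: downset_def)

lemma downset_monomial: "downset K (monomial r u) = {(s, v). (r - s, u - v) \<in> K}"
  by (simp add: downset_def)

text \<open>
  When exponents collide, the coefficient of the sum is the larger of the two, and raising a coefficient
  only enlarges the down-set because \<open>K\<close> contains the nonnegative scalars.
\<close>
lemma downset_add:
  assumes K: "monomial_cone n K"
  shows "downset K (p + q) = downset K p \<union> downset K q"
proof -
  have coeff: "coefficient (p + q) u =
      (if u \<in> Poly_Mapping.keys p
       then if u \<in> Poly_Mapping.keys q then max (coefficient p u) (coefficient q u) else coefficient p u
       else coefficient q u)" for u
    by (cases "Poly_Mapping.lookup p u"; cases "Poly_Mapping.lookup q u")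
      (auto simp: coefficient_def lookup_add in_keys_iff)
  have up: "(r', w) \<in> K" if "(r, w) \<in> K" "r \<le> r'" for r r' w
    using monomial_coneD(4)[OF K that(1) monomial_coneD(2)[OF K, of "r' - r"]] that(2) by simp
  show ?thesis
  proof (intro equalityI subrelI)
    fix s v assume "(s, v) \<in> downset K (p + q)"
    then show "(s, v) \<in> downset K p \<union> downset K q"
      by (auto simp: downset_def keys_add_trop coeff max_def split: if_splits)
  next
    fix s v assume "(s, v) \<in> downset K p \<union> downset K q"
    then consider u where "u \<in> Poly_Mapping.keys p" "(coefficient p u - s, u - v) \<in> K"
      | u where "u \<in> Poly_Mapping.keys q" "(coefficient q u - s, u - v) \<in> K"
      by (auto simp: downset_def)
    then show "(s, v) \<in> downset K (p + q)"
    proof cases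
      case 1
      from 1(2) have "(coefficient (p + q) u - s, u - v) \<in> K"
        by (rule up) (simp add: coeff 1(1))
      with 1(1) show ?thesis by (auto simp: downset_def keys_add_trop)
    next
      case 2
      from 2(2) have "(coefficient (p + q) u - s, u - v) \<in> K"
        by (rule up) (simp add: coeff 2(1))
      with 2(1) show ?thesis by (auto simp: downset_def keys_add_trop)
    qed
  qed
qed

text \<open>
  Both sides are additive in \<open>p\<close> and in \<open>q\<close>, which reduces the claim to two monomials and so avoids
  the convolution formula for the coefficients of a product.
\<close>
lemma downset_mult:
  assumes K: "monomial_cone n K" and p: "p \<in> laurent n" and q: "q \<in> laurent n"
  shows "downset K (p * q) = case_prod (+) ` (downset K p \<times> downset K q)"
  using p
proof (induction p rule: laurent_induct)
  case (add r u p)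
  have "downset K (monomial r u * q) = case_prod (+) ` (downset K (monomial r u) \<times> downset K q)"
    using q
  proof (induction q rule: laurent_induct)
    case (add s v q)
    have "downset K (monomial r u * monomial s v) =
        case_prod (+) ` (downset K (monomial r u) \<times> downset K (monomial s v))" (is "?L = ?R")
    proof (intro equalityI subrelI)
      fix t w assume "(t, w) \<in> ?L"
      then have "(t - r, w - u) \<in> downset K (monomial s v)" "(r, u) \<in> downset K (monomial r u)"
        using monomial_coneD(2)[OF K, of 0] by (auto simp: downset_monomial monomial_mult algebra_simps)
      then show "(t, w) \<in> ?R"
        by (intro image_eqI[of _ _ "((r, u), (t - r, w - u))"]) auto
    next
      fix t w assume "(t, w) \<in> ?R"
      then obtain r' u' s' v' where "(r', u') \<in> downset K (monomial r u)"
        "(s', v') \<in> downset K (monomial s v)" "(t, w) = (r' + s', u' + v')"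
        by auto
      then show "(t, w) \<in> ?L"
        using monomial_coneD(4)[OF K, of "r - r'" "u - u'" "s - s'" "v - v'"]
        by (simp add: downset_monomial monomial_mult algebra_simps)
    qed
    then show ?case
      using add(3) by (simp add: distrib_left downset_add[OF K] image_Un Sigma_Un_distrib2)
  qed simp
  with add(3) show ?case
    by (simp add: distrib_right downset_add[OF K] image_Un Sigma_Un_distrib1)
qed simp

lemma downset_downward:
  assumes K: "monomial_cone n K" and "(r, u) \<in> downset K p" "(r - s, u - v) \<in> K"
  shows "(s, v) \<in> downset K p"
proof -
  obtain w where "w \<in> Poly_Mapping.keys p" "(coefficient p w - r, w - u) \<in> K"
    using assms(2) by (auto simp: downset_def)
  then show ?thesis
    using monomial_coneD(4)[OF K _ assms(3)] by (fastforce simp: downset_def)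
qed

text \<open>
  By totality the finitely many monomials of \<open>p\<close> have a largest one, which generates the down-set.
\<close>
lemma downset_principal:
  assumes K: "monomial_cone n K" and p: "p \<in> laurent n"
  shows "downset K p = {} \<or> (\<exists>r u. u \<in> exponents n \<and> downset K p = downset K (monomial r u))"
  using p
proof (induction p rule: laurent_induct)
  case (add r u p)
  show ?case
  proof (cases "downset K p = {}")
    case True
    with add(1) show ?thesis by (auto simp: downset_add[OF K])
  next
    case False
    with add obtain s v where sv: "v \<in> exponents n" "downset K p = downset K (monomial s v)"
      by blast
    have "(r - s, u - v) \<in> K \<or> (s - r, v - u) \<in> K"
      using monomial_coneD(5)[OF K, of "u - v" "r - s"] add(1) sv(1) by simp
    then have "downset K (monomial s v) \<subseteq> downset K (monomial r u) \<or>
        downset K (monomial r u) \<subseteq> downset K (monomial s v)"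
      using downset_downward[OF K, of s v "monomial r u"] downset_downward[OF K, of r u "monomial s v"]
        monomial_coneD(4)[OF K]
      by (fastforce simp: downset_monomial)
    then show ?thesis
      using add(1) sv by (auto simp: downset_add[OF K])
  qed
qed simp

text \<open>
  This is primality in the form of strict monotonicity: if \<open>x\<close> and \<open>y\<close> are the leading monomials of
  \<open>a\<close> and \<open>c\<close>, and \<open>b\<close> and \<open>d\<close> lie strictly below them, then \<open>x + y\<close> lies below \<open>a c\<close> but
  not below \<open>a d\<close> or \<open>b c\<close>.
\<close>
lemma downset_cancel:
  assumes K: "monomial_cone n K"
    and S: "a \<in> laurent n" "b \<in> laurent n" "c \<in> laurent n" "d \<in> laurent n"
    and ba: "\<not> downset K a \<subseteq> downset K b" and dc: "\<not> downset K c \<subseteq> downset K d"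
  shows "downset K (a * c + b * d) \<noteq> downset K (a * d + b * c)"
proof -
  obtain r u where a: "u \<in> exponents n" "downset K a = downset K (monomial r u)"
    using downset_principal[OF K S(1)] ba by auto
  obtain s v where c: "v \<in> exponents n" "downset K c = downset K (monomial s v)"
    using downset_principal[OF K S(3)] dc by auto
  have top: "(r, u) \<in> downset K a" "(s, v) \<in> downset K c"
    using monomial_coneD(2)[OF K, of 0] a c by (auto simp: downset_monomial)
  have nb: "(r, u) \<notin> downset K b"
  proof
    assume "(r, u) \<in> downset K b"
    then have "downset K a \<subseteq> downset K b"
      using downset_downward[OF K] by (auto simp: a downset_monomial)
    with ba show False by blast
  qed
  have nd: "(s, v) \<notin> downset K d"
  proof
    assume "(s, v) \<in> downset K d"
    then have "downset K c \<subseteq> downset K d"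
      using downset_downward[OF K] by (auto simp: c downset_monomial)
    with dc show False by blast
  qed
  have "(r, u) + (s, v) \<in> downset K (a * c + b * d)"
    using top S by (simp add: downset_add[OF K] downset_mult[OF K] rev_image_eqI[of "((r, u), (s, v))"])
  moreover have "(r, u) + (s, v) \<notin> downset K (a * d)"
  proof
    assume "(r, u) + (s, v) \<in> downset K (a * d)"
    then obtain r' u' s' v' where *: "(r', u') \<in> downset K a" "(s', v') \<in> downset K d"
      "r + s = r' + s'" "u + v = u' + v'"
      using S by (auto simp: downset_mult[OF K])
    then have "(s' - s, v' - v) = (r - r', u - u')"
      by (simp add: algebra_simps)
    then have "(s' - s, v' - v) \<in> K"
      using *(1) by (simp add: a downset_monomial)
    with nd *(2) downset_downward[OF K] show False by blast
  qed
  moreover have "(r, u) + (s, v) \<notin> downset K (b * c)"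
  proof
    assume "(r, u) + (s, v) \<in> downset K (b * c)"
    then obtain r' u' s' v' where *: "(r', u') \<in> downset K b" "(s', v') \<in> downset K c"
      "r + s = r' + s'" "u + v = u' + v'"
      using S by (auto simp: downset_mult[OF K])
    then have "(r' - r, u' - u) = (s - s', v - v')"
      by (simp add: algebra_simps)
    then have "(r' - r, u' - u) \<in> K"
      using *(2) by (simp add: c downset_monomial)
    with nb *(1) downset_downward[OF K] show False by blast
  qed
  ultimately show ?thesis by (auto simp: downset_add[OF K])
qed

definition congruence_of_cone ::
  "nat \<Rightarrow> (real \<times> (nat \<Rightarrow>\<^sub>0 int)) set \<Rightarrow> (((nat \<Rightarrow>\<^sub>0 int) \<Rightarrow>\<^sub>0 trop) \<times> ((nat \<Rightarrow>\<^sub>0 int) \<Rightarrow>\<^sub>0 trop)) set" where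
  "congruence_of_cone n K = {(p, q). p \<in> laurent n \<and> q \<in> laurent n \<and> downset K p = downset K q}"

text \<open>
  Of two different down-sets one is not contained in the other. Exchanging the members of a pair merely
  exchanges the two components of the twisted product, so in each pair it may be assumed to be the first
  one, and primality reduces to the cancellation lemma.
\<close>
lemma prime_congruence_of_cone:
  assumes K: "monomial_cone n K"
  shows "prime_congruence (laurent n) (congruence_of_cone n K)"
  unfolding prime_congruence_def
proof (intro conjI allI impI)
  show "congruence (laurent n) (congruence_of_cone n K)"
    unfolding congruence_def
    by (auto simp: congruence_of_cone_def equiv_def refl_on_def sym_def trans_def
        downset_add[OF K] downset_mult[OF K])
  have "(0, 0) \<in> downset K 1"
    using monomial_coneD(2)[OF K, of 0] by (simp flip: monomial_one add: downset_monomial)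
  then have "(0, 1) \<in> laurent n \<times> laurent n - congruence_of_cone n K"
    by (auto simp: congruence_of_cone_def)
  then show "laurent n \<times> laurent n - congruence_of_cone n K \<noteq> {}" by blast
next
  fix a b c d
  assume "(a, b) \<in> laurent n \<times> laurent n - congruence_of_cone n K"
    "(c, d) \<in> laurent n \<times> laurent n - congruence_of_cone n K"
  then have S: "a \<in> laurent n" "b \<in> laurent n" "c \<in> laurent n" "d \<in> laurent n"
    and "downset K a \<noteq> downset K b" "downset K c \<noteq> downset K d"
    by (auto simp: congruence_of_cone_def)
  then consider "\<not> downset K a \<subseteq> downset K b" "\<not> downset K c \<subseteq> downset K d"
    | "\<not> downset K a \<subseteq> downset K b" "\<not> downset K d \<subseteq> downset K c"
    | "\<not> downset K b \<subseteq> downset K a" "\<not> downset K c \<subseteq> downset K d"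
    | "\<not> downset K b \<subseteq> downset K a" "\<not> downset K d \<subseteq> downset K c"
    by blast
  then have "downset K (a * c + b * d) \<noteq> downset K (a * d + b * c)"
  proof cases
    case 1 then show ?thesis using downset_cancel[OF K] S by blast
  next
    case 2 then show ?thesis using downset_cancel[OF K S(1,2,4,3)] by metis
  next
    case 3 then show ?thesis using downset_cancel[OF K S(2,1,3,4)] by (metis add.commute)
  next
    case 4 then show ?thesis using downset_cancel[OF K S(2,1,4,3)] by (metis add.commute)
  qed
  then show "(a * c + b * d, a * d + b * c) \<in> laurent n \<times> laurent n - congruence_of_cone n K"
    using S by (auto simp: congruence_of_cone_def)
qed

definition cone_of_congruence where
  "cone_of_congruence n P = {(r, u). u \<in> exponents n \<and> (monomial r u + 1, monomial r u) \<in> P}"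

lemma cone_of_congruence_of_cone:
  assumes K: "monomial_cone n K"
  shows "cone_of_congruence n (congruence_of_cone n K) = K"
proof -
  have "downset K (monomial r u) \<union> downset K 1 = downset K (monomial r u) \<longleftrightarrow> (r, u) \<in> K" for r u
  proof
    assume "downset K (monomial r u) \<union> downset K 1 = downset K (monomial r u)"
    moreover have "(0, 0) \<in> downset K 1"
      using monomial_coneD(2)[OF K, of 0] by (simp flip: monomial_one add: downset_monomial)
    ultimately have "(0, 0) \<in> downset K (monomial r u)" by blast
    then show "(r, u) \<in> K" by (simp add: downset_monomial)
  next
    assume "(r, u) \<in> K"
    then have "(s, v) \<in> downset K (monomial r u)" if "(s, v) \<in> downset K 1" for s v
      using that monomial_coneD(4)[OF K, of r u "-s" "-v"]
      by (simp flip: monomial_one add: downset_monomial)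
    then show "downset K (monomial r u) \<union> downset K 1 = downset K (monomial r u)" by auto
  qed
  then show ?thesis
    using monomial_coneD(3)[OF K]
    by (auto simp: cone_of_congruence_def congruence_of_cone_def downset_add[OF K])
qed

section \<open>The cone of monomials of a prime congruence\<close>

locale prime_laurent_congruence =
  fixes n P
  assumes prime: "prime_congruence (laurent n) P"
begin

lemma congruence_rules:
  "p \<in> laurent n \<Longrightarrow> (p, p) \<in> P"
  "(p, q) \<in> P \<Longrightarrow> (q, p) \<in> P"
  "(p, q) \<in> P \<Longrightarrow> (q, r) \<in> P \<Longrightarrow> (p, r) \<in> P"
  "(p, q) \<in> P \<Longrightarrow> (r, s) \<in> P \<Longrightarrow> (p + r, q + s) \<in> P"
  "(p, q) \<in> P \<Longrightarrow> (r, s) \<in> P \<Longrightarrow> (p * r, q * s) \<in> P"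
  "(p, q) \<in> P \<Longrightarrow> p \<in> laurent n \<and> q \<in> laurent n"
  using prime unfolding prime_congruence_def congruence_def equiv_def
  by (auto dest: refl_onD symD transD)

lemma prime_cases:
  assumes "a \<in> laurent n" "b \<in> laurent n" "c \<in> laurent n" "d \<in> laurent n"
    "(a * c + b * d, a * d + b * c) \<in> P"
  shows "(a, b) \<in> P \<or> (c, d) \<in> P"
  using assms prime unfolding prime_congruence_def by blast

text \<open>
  The order of the idempotent quotient semiring, pulled back to polynomials.
\<close>
definition le where "le p q \<longleftrightarrow> (p + q, q) \<in> P"

lemma le_antisym: "le p q \<Longrightarrow> le q p \<Longrightarrow> (p, q) \<in> P"
  unfolding le_def using congruence_rules(2,3) by (metis add.commute)

lemma le_of_eq: "(p, q) \<in> P \<Longrightarrow> le p q"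
  unfolding le_def using congruence_rules(4)[of p q q q] congruence_rules(1,6) by (metis laurent_add_idem)

lemma le_trans:
  assumes "le p q" "le q r" "p \<in> laurent n" "q \<in> laurent n" "r \<in> laurent n" shows "le p r"
proof -
  have "(p + r, p + (q + r)) \<in> P"
    using assms congruence_rules unfolding le_def by blast
  moreover have "(p + (q + r), q + r) \<in> P"
    using assms congruence_rules(4)[of "p + q" q r r] congruence_rules(1) unfolding le_def by (simp add: add.assoc)
  ultimately show ?thesis
    using assms congruence_rules(3) unfolding le_def by blast
qed

lemma le_add: "p \<in> laurent n \<Longrightarrow> q \<in> laurent n \<Longrightarrow> le p (p + q)"
  unfolding le_def using congruence_rules(1)[of "p + q"] by (simp add: laurent_add_idem flip: add.assoc)

lemma add_le:
  assumes "le p r" "le q r" "p \<in> laurent n" "q \<in> laurent n" "r \<in> laurent n" shows "le (p + q) r"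
proof -
  have "(p + r + (q + r), r + r) \<in> P"
    using assms congruence_rules(4) unfolding le_def by blast
  moreover have "p + r + (q + r) = p + q + (r + r)" by (simp add: ac_simps)
  ultimately show ?thesis by (simp add: le_def laurent_add_idem)
qed

lemma mult_le:
  assumes "le p q" "m \<in> laurent n" shows "le (m * p) (m * q)"
  using congruence_rules(5)[OF congruence_rules(1)[OF assms(2)]] assms unfolding le_def by (metis distrib_left)

text \<open>
  Apply primality to the pairs \<open>(p + q, p)\<close> and \<open>(p + q, q)\<close>: the two components of their twisted
  product are equal, since addition is idempotent. Hence \<open>p + q\<close> is equivalent to \<open>p\<close> or to \<open>q\<close>.
\<close>
lemma le_total:
  assumes "p \<in> laurent n" "q \<in> laurent n" shows "le p q \<or> le q p"
proof -
  let ?s = "p + q"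
  have "?s * ?s + p * q = ?s * q + p * ?s"
  proof -
    have "?s * ?s + p * q = p * p + q * q + (p * q + p * q) + p * q"
      by (simp add: algebra_simps)
    also have "\<dots> = p * p + q * q + (p * q + p * q)"
      by (metis add.assoc laurent_add_idem)
    also have "\<dots> = ?s * q + p * ?s" by (simp add: algebra_simps)
    finally show ?thesis .
  qed
  then have "(?s, p) \<in> P \<or> (?s, q) \<in> P"
    using prime_cases[of ?s p ?s q] assms congruence_rules(1) by simp
  then show ?thesis by (auto simp: le_def add.commute)
qed

text \<open>
  By totality \<open>p + q\<close> is equivalent to one of its summands. Iterated, this says that a monomial below a
  polynomial is below one of its monomials, which is why comparisons of monomials determine the congruence.
\<close>
lemma le_add_cases:
  assumes "le m (p + q)" "m \<in> laurent n" "p \<in> laurent n" "q \<in> laurent n"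
  shows "le m p \<or> le m q"
  using le_total[OF assms(3,4)]
proof
  assume "le p q"
  then have "le (p + q) q" unfolding le_def[of p] by (rule le_of_eq)
  then show ?thesis using assms le_trans laurent_subsemiring(3) by blast
next
  assume "le q p"
  then have "le (p + q) p" unfolding le_def[of q] add.commute[of q] by (rule le_of_eq)
  then show ?thesis using assms le_trans laurent_subsemiring(3) by blast
qed

lemma not_monomial_le_zero:
  assumes u: "u \<in> exponents n" shows "\<not> le (monomial r u) 0"
proof
  assume "le (monomial r u) 0"
  \<comment> \<open>Monomials are units, so a monomial equivalent to \<open>0\<close> would collapse the whole semiring.\<close>
  then have "(monomial (- r) (- u) * monomial r u, monomial (- r) (- u) * 0) \<in> P"
    using congruence_rules(5)[OF congruence_rules(1)[of "monomial (- r) (- u)"], of "monomial r u" 0] u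
    unfolding le_def by simp
  then have one: "(1, 0) \<in> P" by (simp add: monomial_mult monomial_one)
  have "(p, 0) \<in> P" if "p \<in> laurent n" for p
    using congruence_rules(5)[OF one congruence_rules(1)[OF that]] by simp
  then have "laurent n \<times> laurent n \<subseteq> P" using congruence_rules(2,3) by blast
  with prime show False unfolding prime_congruence_def by blast
qed

text \<open>
  Multiply by the inverse of the smaller monomial.
\<close>
lemma monomial_le_monomial:
  assumes "u \<in> exponents n" "v \<in> exponents n"
  shows "le (monomial r u) (monomial s v) \<longleftrightarrow> (s - r, v - u) \<in> cone_of_congruence n P"
proof
  assume "le (monomial r u) (monomial s v)"
  from mult_le[OF this, of "monomial (- r) (- u)"] assms
  show "(s - r, v - u) \<in> cone_of_congruence n P"
    by (simp add: le_def cone_of_congruence_def monomial_mult monomial_one algebra_simps)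
next
  assume "(s - r, v - u) \<in> cone_of_congruence n P"
  then have "le 1 (monomial (s - r) (v - u))"
    by (simp add: le_def cone_of_congruence_def add.commute)
  from mult_le[OF this, of "monomial r u"] assms
  show "le (monomial r u) (monomial s v)" by (simp add: monomial_mult)
qed

lemma monomial_cone_of_congruence: "monomial_cone n (cone_of_congruence n P)"
proof -
  let ?K = "cone_of_congruence n P"
  have iff: "(r, u) \<in> ?K \<longleftrightarrow> u \<in> exponents n \<and> le (monomial 0 0) (monomial r u)" for r u
    using monomial_le_monomial[of 0 u 0 r] by (auto simp: cone_of_congruence_def)
  have "(r + s, u + v) \<in> ?K" if "(r, u) \<in> ?K" "(s, v) \<in> ?K" for r s u v
  proof -
    have "le (monomial r u) (monomial (r + s) (u + v))"
      using that monomial_le_monomial[of u "u + v" r "r + s"] by (simp add: iff)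
    then show ?thesis
      using that le_trans[of "monomial 0 0" "monomial r u"] by (auto simp: iff)
  qed
  moreover have "(r, u) \<in> ?K \<or> (- r, - u) \<in> ?K" if "u \<in> exponents n" for r u
    using le_total[of "monomial 0 0" "monomial r u"] that monomial_le_monomial[of 0 u 0 r]
      monomial_le_monomial[of u 0 r 0]
    by auto
  moreover have "(r, 0) \<in> ?K" if "0 \<le> r" for r
  proof -
    have "monomial r 0 + 1 = monomial r 0"
      using that by (simp add: monomial_def one_trop_def flip: single_one single_add)
    then show ?thesis using congruence_rules(1) by (simp add: cone_of_congruence_def)
  qed
  ultimately show ?thesis
    by (auto simp: monomial_cone_def total_cone_def) (simp add: iff)
qed

text \<open>
  The down-set, defined by comparing with single monomials of \<open>p\<close>, coincides with the set of all
  monomials below \<open>p\<close>; this is the bridge between the two constructions.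
\<close>
lemma downset_cone_of_congruence:
  assumes p: "p \<in> laurent n"
  shows "downset (cone_of_congruence n P) p = {(s, v). v \<in> exponents n \<and> le (monomial s v) p}"
proof -
  let ?K = "cone_of_congruence n P"
  have exps: "v \<in> exponents n" if sv: "(s, v) \<in> downset ?K p" for s v
  proof -
    obtain u where u: "u \<in> Poly_Mapping.keys p" "u - v \<in> exponents n"
      using sv by (auto simp: downset_def cone_of_congruence_def)
    moreover have "u \<in> exponents n" using p u by (auto simp: laurent_def)
    ultimately show ?thesis using exponents_group(4)[of u n "u - v"] by simp
  qed
  have "(s, v) \<in> downset ?K p \<longleftrightarrow> le (monomial s v) p" if v: "v \<in> exponents n" for s v
    using p
  proof (induction p rule: laurent_induct)
    case zero
    then show ?case using not_monomial_le_zero[OF v] by simp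
  next
    case (add r u q)
    have "le (monomial s v) (monomial r u + q) \<longleftrightarrow> le (monomial s v) (monomial r u) \<or> le (monomial s v) q"
      using le_add_cases[of "monomial s v" "monomial r u" q] add(1,2) v
        le_trans[OF _ le_add[of "monomial r u" q]] le_trans[OF _ le_add[of q "monomial r u"]]
      by (auto simp: add.commute)
    moreover have "(s, v) \<in> downset ?K (monomial r u) \<longleftrightarrow> le (monomial s v) (monomial r u)"
      using add(1) v by (simp add: downset_monomial monomial_le_monomial)
    ultimately show ?case
      using add(3) by (simp add: downset_add[OF monomial_cone_of_congruence])
  qed
  with exps show ?thesis by auto
qed

lemma congruence_of_cone_of_congruence: "congruence_of_cone n (cone_of_congruence n P) = P"
proof -
  let ?K = "cone_of_congruence n P"
  have sub: "le p q" if p: "p \<in> laurent n" and q: "q \<in> laurent n" and le: "downset ?K p \<subseteq> downset ?K q" for p q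
    using p le
  proof (induction p rule: laurent_induct)
    case zero
    then show ?case using congruence_rules(1) q by (simp add: le_def)
  next
    case (add r u p)
    have "(r, u) \<in> downset ?K (monomial r u)"
      using add(1) congruence_rules(1) by (simp add: downset_cone_of_congruence le_of_eq)
    then have "le (monomial r u) q"
      using add(4) q by (auto simp: downset_add[OF monomial_cone_of_congruence] downset_cone_of_congruence)
    moreover have "le p q"
      using add by (auto simp: downset_add[OF monomial_cone_of_congruence])
    ultimately show ?case using add(1,2) q by (intro add_le) auto
  qed
  have "downset ?K p \<subseteq> downset ?K q" if "(p, q) \<in> P" for p q
    using congruence_rules(6)[OF that] le_trans[OF _ le_of_eq[OF that]]
    by (auto simp: downset_cone_of_congruence)
  then have "(p, q) \<in> congruence_of_cone n ?K" if "(p, q) \<in> P" for p q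
    using congruence_rules(2,6) that unfolding congruence_of_cone_def by blast
  moreover have "(p, q) \<in> P" if "(p, q) \<in> congruence_of_cone n ?K" for p q
    using that sub[of p q] sub[of q p] le_antisym by (auto simp: congruence_of_cone_def)
  ultimately show ?thesis by auto
qed

end

text \<open>
  If \<open>K\<close>-down-sets are nested then so are \<open>K'\<close>-down-sets, because each monomial of \<open>p\<close> is
  dominated by a monomial of \<open>q\<close>, and this comparison survives the passage to the larger cone.
\<close>
lemma congruence_of_cone_mono:
  assumes K: "monomial_cone n K" "monomial_cone n K'" and sub: "K \<subseteq> K'"
  shows "congruence_of_cone n K \<subseteq> congruence_of_cone n K'"
proof -
  have le: "downset K' p \<subseteq> downset K' q" if p: "p \<in> laurent n" and le: "downset K p \<subseteq> downset K q" for p q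
    using p le
  proof (induction p rule: laurent_induct)
    case (add r u p)
    have "(r, u) \<in> downset K (monomial r u)"
      using monomial_coneD(2)[OF K(1), of 0] by (simp add: downset_monomial)
    then have "(r, u) \<in> downset K q"
      using add(4) by (auto simp: downset_add[OF K(1)])
    then have "(r, u) \<in> downset K' q"
      using sub by (auto simp: downset_def)
    then have "downset K' (monomial r u) \<subseteq> downset K' q"
      using downset_downward[OF K(2)] by (auto simp: downset_monomial)
    with add show ?case by (auto simp: downset_add[OF K(1)] downset_add[OF K(2)])
  qed simp
  show ?thesis
    by (clarsimp simp: congruence_of_cone_def) (metis le order_refl subset_antisym)
qed

section \<open>The real functional of a total preorder with an order unit\<close>

text \<open>
  Hoelder's construction. The element \<open>e\<close> is an order unit that is not equivalent to \<open>0\<close>; comparing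
  multiples of \<open>x\<close> with multiples of \<open>e\<close> measures \<open>x\<close> by a real number. The bound only asks for some
  multiple of \<open>x\<close> to lie below a multiple of \<open>e\<close>, which is what a rational basis provides.
\<close>
locale order_unit_cone =
  fixes G K :: "'a::real_vector set" and e :: 'a
  assumes diff: "x \<in> G \<Longrightarrow> y \<in> G \<Longrightarrow> x - y \<in> G"
    and cone: "total_cone G K"
    and e: "e \<in> K" "- e \<notin> K"
    and unit: "x \<in> G \<Longrightarrow> \<exists>N d. d > 0 \<and> of_int N *\<^sub>R e - of_int d *\<^sub>R x \<in> K"
begin

lemma G_closed: "0 \<in> G" "x \<in> G \<Longrightarrow> - x \<in> G" "x \<in> G \<Longrightarrow> y \<in> G \<Longrightarrow> x + y \<in> G"
proof -
  show z: "0 \<in> G" using diff[of e e] e(1) total_coneD(1)[OF cone] by auto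
  show m: "- x \<in> G" if "x \<in> G" for x using diff[OF z that] by simp
  show "x + y \<in> G" if "x \<in> G" "y \<in> G" for x y using diff[OF that(1) m[OF that(2)]] by simp
qed

lemma K_zero: "0 \<in> K"
  using total_coneD(3)[OF cone G_closed(1)] by simp

lemma K_add: "x \<in> K \<Longrightarrow> y \<in> K \<Longrightarrow> x + y \<in> K"
  using total_coneD(2)[OF cone] .

lemma G_int: assumes "x \<in> G" shows "of_int k *\<^sub>R x \<in> G"
proof -
  have "of_nat j *\<^sub>R x \<in> G" for j
    using assms G_closed by (induction j) (auto simp: scaleR_left_distrib)
  then show ?thesis
    by (cases k) (auto simp: scaleR_left_distrib simp del: of_nat_Suc dest: G_closed(2))
qed

lemma K_int: assumes "x \<in> K" "0 \<le> k" shows "of_int k *\<^sub>R x \<in> K"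
proof -
  have "of_nat j *\<^sub>R x \<in> K" for j
    using assms(1) K_zero K_add by (induction j) (auto simp: scaleR_left_distrib)
  with assms(2) show ?thesis
    by (cases k rule: int_cases) auto
qed

lemma K_neg: "x \<in> G \<Longrightarrow> x \<notin> K \<Longrightarrow> - x \<in> K"
  using total_coneD(3)[OF cone] by blast

lemma e_int: assumes "of_int k *\<^sub>R e \<in> K" shows "0 \<le> k"
proof (rule ccontr)
  assume "\<not> 0 \<le> k"
  then have "of_int k *\<^sub>R e + of_int (- k - 1) *\<^sub>R e \<in> K"
    using K_add[OF assms K_int[OF e(1), of "- k - 1"]] by linarith
  then show False using e(2) by (simp flip: scaleR_left_distrib)
qed

lemma K_div: assumes "x \<in> G" "0 < k" "of_int k *\<^sub>R x \<in> K" shows "x \<in> K"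
proof (rule ccontr)
  assume "x \<notin> K"
  then have "of_int k *\<^sub>R x + of_int (k - 1) *\<^sub>R (- x) \<in> K"
    using K_add[OF assms(3) K_int[of "- x" "k - 1"]] K_neg assms by simp
  then show False using \<open>x \<notin> K\<close> by (simp add: scaleR_left_diff_distrib)
qed

text \<open>
  The lower half of the Dedekind cut of \<open>x / e\<close>.
\<close>
definition lower_cut :: "'a \<Rightarrow> real set" where
  "lower_cut x = {of_int p / of_int q | p q. 0 < q \<and> of_int q *\<^sub>R x - of_int p *\<^sub>R e \<in> K}"

lemma in_lower_cut:
  "0 < q \<Longrightarrow> of_int q *\<^sub>R x - of_int p *\<^sub>R e \<in> K \<Longrightarrow> of_int p / of_int q \<in> lower_cut x"
  by (auto simp: lower_cut_def)

definition slope :: "'a \<Rightarrow> real" where "slope x = Sup (lower_cut x)"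

lemma lower_cut_bounded:
  assumes "x \<in> G" shows "lower_cut x \<noteq> {}" "bdd_above (lower_cut x)"
proof -
  obtain N d where "d > 0" "of_int N *\<^sub>R e - of_int d *\<^sub>R (- x) \<in> K"
    using unit[OF G_closed(2)[OF assms]] by blast
  then have "of_int (- N) / of_int d \<in> lower_cut x"
    by (intro in_lower_cut) (simp_all add: algebra_simps)
  then show "lower_cut x \<noteq> {}" by blast
  obtain M c where M: "c > 0" "of_int M *\<^sub>R e - of_int c *\<^sub>R x \<in> K"
    using unit[OF assms] by blast
  show "bdd_above (lower_cut x)"
  proof (rule bdd_aboveI)
    fix t assume "t \<in> lower_cut x"
    then obtain p q where t: "t = of_int p / of_int q" "0 < q" "of_int q *\<^sub>R x - of_int p *\<^sub>R e \<in> K"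
      by (auto simp: lower_cut_def)
    have "of_int q *\<^sub>R (of_int M *\<^sub>R e - of_int c *\<^sub>R x)
        + of_int c *\<^sub>R (of_int q *\<^sub>R x - of_int p *\<^sub>R e) \<in> K"
      using M t by (intro K_add K_int) auto
    then have "of_int (q * M - c * p) *\<^sub>R e \<in> K" by (simp add: algebra_simps)
    then have "c * p \<le> q * M" using e_int[of "q * M - c * p"] by linarith
    then have "real_of_int c * real_of_int p \<le> real_of_int q * real_of_int M"
      by (metis of_int_le_iff of_int_mult)
    then show "t \<le> of_int M / of_int c" unfolding t(1) using M(1) t(2) by (simp add: field_simps)
  qed
qed

text \<open>
  Comparison with a fraction inside the cut, followed by division by the positive integer \<open>q'\<close>, which
  is legitimate in a totally preordered group.
\<close>
lemma below_slope:
  assumes x: "x \<in> G" and q: "0 < q" and p: "of_int p < of_int q * slope x"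
  shows "of_int q *\<^sub>R x - of_int p *\<^sub>R e \<in> K"
proof -
  have "of_int p / of_int q < slope x" using p q by (simp add: field_simps)
  then obtain t where "t \<in> lower_cut x" "of_int p / of_int q < t"
    unfolding slope_def using less_cSup_iff[OF lower_cut_bounded[OF x]] by blast
  then obtain p' q' where t: "of_int p / real_of_int q < of_int p' / of_int q'" "0 < q'"
    "of_int q' *\<^sub>R x - of_int p' *\<^sub>R e \<in> K"
    by (auto simp: lower_cut_def)
  then have "real_of_int p * real_of_int q' < real_of_int p' * real_of_int q" using q by (simp add: field_simps)
  then have "p * q' < p' * q" by (metis of_int_less_iff of_int_mult)
  then have "of_int q *\<^sub>R (of_int q' *\<^sub>R x - of_int p' *\<^sub>R e) + of_int (p' * q - p * q') *\<^sub>R e \<in> K"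
    using t q e by (intro K_add K_int) auto
  then have "of_int q' *\<^sub>R (of_int q *\<^sub>R x - of_int p *\<^sub>R e) \<in> K"
    by (simp add: algebra_simps)
  with t(2) show ?thesis
    using K_div[OF diff[OF G_int[OF x] G_int], of e q' q p] e(1) total_coneD(1)[OF cone] by blast
qed

lemma above_slope:
  assumes x: "x \<in> G" and q: "0 < q" and p: "of_int q * slope x < of_int p"
  shows "of_int p *\<^sub>R e - of_int q *\<^sub>R x \<in> K"
proof (rule ccontr)
  assume *: "of_int p *\<^sub>R e - of_int q *\<^sub>R x \<notin> K"
  have "of_int p *\<^sub>R e - of_int q *\<^sub>R x \<in> G"
    using x e(1) total_coneD(1)[OF cone] by (intro diff G_int) auto
  with * have "of_int q *\<^sub>R x - of_int p *\<^sub>R e \<in> K"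
    using K_neg by (metis minus_diff_eq)
  then have "of_int p / of_int q \<in> lower_cut x" using q by (auto simp: lower_cut_def)
  then have "of_int p / of_int q \<le> slope x"
    unfolding slope_def by (intro cSup_upper lower_cut_bounded(2) x)
  with p q show False by (simp add: field_simps)
qed

text \<open>
  For every \<open>q\<close> the integer parts of \<open>q x\<close>, \<open>q y\<close> and \<open>q (x + y)\<close> relative to \<open>e\<close> are additive up
  to a bounded error, because the corresponding inequalities can be added. Dividing by \<open>q\<close> removes the
  error.
\<close>
lemma slope_add:
  assumes x: "x \<in> G" and y: "y \<in> G" shows "slope (x + y) = slope x + slope y"
proof -
  have approx: "\<exists>a a'. a' = a + 2 \<and> of_int q *\<^sub>R z - of_int a *\<^sub>R e \<in> K
      \<and> of_int a' *\<^sub>R e - of_int q *\<^sub>R z \<in> K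
      \<and> of_int a \<le> of_int q * slope z \<and> of_int q * slope z \<le> of_int a'"
    if z: "z \<in> G" and q: "0 < q" for z and q :: int
  proof -
    \<comment> \<open>Both \<open>a\<close> and \<open>a + 2\<close> differ from \<open>q * slope z\<close>, as the cut decides only strict inequalities.\<close>
    define a where "a = \<lceil>of_int q * slope z\<rceil> - 1"
    have "of_int a < of_int q * slope z" "of_int q * slope z < of_int (a + 2)"
      unfolding a_def by linarith+
    then show ?thesis
      using below_slope[OF z q, of a] above_slope[OF z q, of "a + 2"]
      by (intro exI[of _ a] exI[of _ "a + 2"]) auto
  qed
  have small: "of_int q * \<bar>slope (x + y) - slope x - slope y\<bar> \<le> 8" if q: "0 < q" for q :: int
  proof -
    obtain a a' where a: "a' = a + 2" "of_int q *\<^sub>R x - of_int a *\<^sub>R e \<in> K" "of_int a' *\<^sub>R e - of_int q *\<^sub>R x \<in> K"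
      "of_int a \<le> of_int q * slope x" "of_int q * slope x \<le> of_int a'"
      using approx[OF x q] by blast
    obtain b b' where b: "b' = b + 2" "of_int q *\<^sub>R y - of_int b *\<^sub>R e \<in> K" "of_int b' *\<^sub>R e - of_int q *\<^sub>R y \<in> K"
      "of_int b \<le> of_int q * slope y" "of_int q * slope y \<le> of_int b'"
      using approx[OF y q] by blast
    obtain c c' where c: "c' = c + 2" "of_int q *\<^sub>R (x + y) - of_int c *\<^sub>R e \<in> K" "of_int c' *\<^sub>R e - of_int q *\<^sub>R (x + y) \<in> K"
      "of_int c \<le> of_int q * slope (x + y)" "of_int q * slope (x + y) \<le> of_int c'"
      using approx[OF G_closed(3)[OF x y] q] by blast
    have "(of_int q *\<^sub>R x - of_int a *\<^sub>R e) + (of_int q *\<^sub>R y - of_int b *\<^sub>R e)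
        + (of_int c' *\<^sub>R e - of_int q *\<^sub>R (x + y)) \<in> K"
      using a b c by (intro K_add)
    then have "of_int (c' - a - b) *\<^sub>R e \<in> K" by (simp add: algebra_simps)
    then have 1: "a + b \<le> c + 2" using e_int[of "c' - a - b"] c(1) by linarith
    have "(of_int a' *\<^sub>R e - of_int q *\<^sub>R x) + (of_int b' *\<^sub>R e - of_int q *\<^sub>R y)
        + (of_int q *\<^sub>R (x + y) - of_int c *\<^sub>R e) \<in> K"
      using a b c by (intro K_add)
    then have "of_int (a' + b' - c) *\<^sub>R e \<in> K" by (simp add: algebra_simps)
    then have 2: "c \<le> a + b + 4" using e_int[of "a' + b' - c"] a(1) b(1) by linarith
    have "\<bar>of_int q * slope (x + y) - of_int q * slope x - of_int q * slope y\<bar> \<le> 8"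
      using a(1,4,5) b(1,4,5) c(1,4,5) 1 2 by linarith
    then have "\<bar>of_int q * (slope (x + y) - slope x - slope y)\<bar> \<le> 8"
      by (simp add: algebra_simps)
    then show ?thesis using q by (simp add: abs_mult)
  qed
  show ?thesis
  proof (rule ccontr)
    assume "slope (x + y) \<noteq> slope x + slope y"
    then have pos: "0 < \<bar>slope (x + y) - slope x - slope y\<bar>" by simp
    then obtain k where k: "8 < real k * \<bar>slope (x + y) - slope x - slope y\<bar>"
      using reals_Archimedean3 by blast
    then have "0 < int k" by (cases k) auto
    from small[OF this] k show False by simp
  qed
qed

lemma slope_nonneg: assumes "x \<in> K" shows "0 \<le> slope x"
proof -
  have "0 \<in> lower_cut x"
    using in_lower_cut[of 1 x 0] assms by simp
  then show ?thesis
    unfolding slope_def using assms total_coneD(1)[OF cone]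
    by (intro cSup_upper lower_cut_bounded(2)) auto
qed

lemma slope_unit: "1 \<le> slope e"
proof -
  have "1 \<in> lower_cut e"
    using in_lower_cut[of 1 e 1] K_zero by simp
  then show ?thesis
    unfolding slope_def using e total_coneD(1)[OF cone]
    by (intro cSup_upper lower_cut_bounded(2)) auto
qed

lemma slope_int: assumes x: "x \<in> G" shows "slope (of_int k *\<^sub>R x) = of_int k * slope x"
proof -
  have zero: "slope 0 = 0" using slope_add[of 0 0] G_closed(1) by simp
  have neg: "slope (- z) = - slope z" if "z \<in> G" for z
    using slope_add[OF that G_closed(2)[OF that]] zero by simp
  have nat: "slope (of_nat j *\<^sub>R x) = of_nat j * slope x" for j
  proof (induction j)
    case (Suc j)
    then show ?case
      using slope_add[OF x, of "of_nat j *\<^sub>R x"] G_int[OF x, of "int j"]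
      by (simp add: algebra_simps)
  qed (simp add: zero)
  show ?thesis
  proof (cases k rule: int_cases2)
    case (nonpos j)
    then show ?thesis using nat[of j] neg[OF G_int[OF x, of "int j"]] by simp
  qed (use nat in simp)
qed

end

section \<open>Real and rational relations between lattice points\<close>

text \<open>
  Over the rationals, \<open>1\<close> and an irrational \<open>t\<close> are independent vectors of the real line.
\<close>
lemma additive_map_killing_one:
  fixes t :: real
  assumes "t \<notin> \<rat>"
  obtains f :: "real \<Rightarrow> real" where "\<And>x y. f (x + y) = f x + f y" "f 1 = 0" "f t = 1"
proof -
  interpret Q: vector_space_pair "\<lambda>q x. of_rat q * x :: real" "\<lambda>q x. of_rat q * x :: real"
    by unfold_locales (auto simp: algebra_simps of_rat_add of_rat_mult)
  have ind: "Q.vs1.independent {1, t}"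
  proof (rule Q.vs1.independent_insertI[OF _ Q.vs1.independent_insertI[OF _ Q.vs1.independent_empty]])
    show "1 \<notin> Q.vs1.span {t}"
    proof
      assume "1 \<in> Q.vs1.span {t}"
      then obtain q where "of_rat q * t = 1"
        unfolding Q.vs1.span_singleton by auto
      then have "t = of_rat (inverse q)"
        by (metis of_rat_inverse inverse_unique mult.commute)
      with assms show False by simp
    qed
    show "t \<notin> Q.vs1.span {}" using assms by auto
  qed
  obtain f where f: "Vector_Spaces.linear (\<lambda>q x. of_rat q * x :: real) (\<lambda>q x. of_rat q * x :: real) f"
    "\<forall>x\<in>{1, t}. f x = (if x = 1 then 0 else 1)"
    using Q.linear_independent_extend[OF ind, of "\<lambda>x. if x = 1 then 0 else 1"] by (elim exE conjE)
  interpret f: Vector_Spaces.linear "\<lambda>q x. of_rat q * x :: real" "\<lambda>q x. of_rat q * x :: real" f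
    by (fact f(1))
  have "t \<noteq> 1" using assms by auto
  with f(2) show ?thesis by (intro that[of f] f.add) auto
qed

lemma common_denominator:
  assumes "finite A" "f ` A \<subseteq> (\<rat> :: real set)"
  obtains d :: int where "d > 0" "\<And>a. a \<in> A \<Longrightarrow> of_int d * f a \<in> \<int>"
proof -
  have "\<exists>d::int. d > 0 \<and> (\<forall>a\<in>A. of_int d * f a \<in> \<int>)"
    using assms
  proof (induction A)
    case empty
    then show ?case by (intro exI[of _ 1]) auto
  next
    case (insert a A)
    then obtain d :: int where d: "d > 0" "\<forall>a\<in>A. of_int d * f a \<in> \<int>" by auto
    obtain p q :: int where q: "q > 0" "f a = of_int p / of_int q"
      using insert.prems by (metis Rats_cases' image_subset_iff insertI1)
    have "of_int (q * d) * f b \<in> \<int>" if "b \<in> insert a A" for b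
    proof (cases "b = a")
      case True
      then have "of_int (q * d) * f b = of_int (d * p)" using q by simp
      then show ?thesis by (metis Ints_of_int)
    next
      case False
      then have "of_int q * (of_int d * f b) \<in> \<int>" using that d(2) Ints_mult Ints_of_int by blast
      moreover have "of_int (q * d) * f b = of_int q * (of_int d * f b)" by simp
      ultimately show ?thesis by metis
    qed
    then show ?case using d(1) q(1) by (intro exI[of _ "q * d"]) auto
  qed
  then show ?thesis using that by blast
qed

lemma lookup_scaleR [simp]: "Poly_Mapping.lookup (c *\<^sub>R x) i = c * Poly_Mapping.lookup (x :: nat \<Rightarrow>\<^sub>0 real) i"
  by (simp add: scaleR_poly_mapping_def)

lemma lookup_map_of_int [simp]:
  "Poly_Mapping.lookup (Poly_Mapping.map real_of_int u) i = of_int (Poly_Mapping.lookup u i)"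
  by (simp add: Poly_Mapping.map.rep_eq when_def)

lemma lookup_snd_sum: "Poly_Mapping.lookup (snd (\<Sum>b\<in>B. c b *\<^sub>R f b)) i
    = (\<Sum>b\<in>B. c b * Poly_Mapping.lookup (snd (f b) :: nat \<Rightarrow>\<^sub>0 real) i)"
  by (simp add: snd_sum lookup_sum)

lemma embed_add: "embed (x + y) = embed x + embed y"
  by (cases x; cases y) (simp add: embed_def poly_mapping_eq_iff fun_eq_iff lookup_add)

lemma embed_minus: "embed (- x) = - embed x"
  by (cases x) (simp add: embed_def poly_mapping_eq_iff fun_eq_iff)

lemma inj_embed: "inj embed"
  by (rule injI) (auto simp: embed_def poly_mapping_eq_iff fun_eq_iff split: prod.splits)

lemma lattice_points_iff:
  "x \<in> lattice_points n \<longleftrightarrow> x \<in> ambient n \<and> (\<forall>i. Poly_Mapping.lookup (snd x) i \<in> \<int>)"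
proof
  assume "x \<in> lattice_points n"
  then show "x \<in> ambient n \<and> (\<forall>i. Poly_Mapping.lookup (snd x) i \<in> \<int>)"
    by (auto simp: lattice_points_def embed_def ambient_def exponents_def in_keys_iff subset_iff)
next
  assume x: "x \<in> ambient n \<and> (\<forall>i. Poly_Mapping.lookup (snd x) i \<in> \<int>)"
  define u where "u = Poly_Mapping.map floor (snd x)"
  have u: "Poly_Mapping.lookup u i = \<lfloor>Poly_Mapping.lookup (snd x) i\<rfloor>" for i
    by (simp add: u_def Poly_Mapping.map.rep_eq when_def)
  have "x = embed (fst x, u)"
    using x by (simp add: embed_def prod_eq_iff poly_mapping_eq_iff fun_eq_iff u)
  moreover have "Poly_Mapping.keys u \<subseteq> Poly_Mapping.keys (snd x)" "Poly_Mapping.keys (snd x) \<subseteq> {..<n}"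
    using x by (auto simp: in_keys_iff u ambient_def)
  then have "u \<in> exponents n"
    unfolding exponents_def by blast
  ultimately show "x \<in> lattice_points n" unfolding lattice_points_def by blast
qed

lemma ambient_iff: "x \<in> ambient n \<longleftrightarrow> (\<forall>i. n \<le> i \<longrightarrow> Poly_Mapping.lookup (snd x) i = 0)"
  by (cases x) (auto simp: ambient_def in_keys_iff subset_iff simp flip: not_less)

lemma subspace_ambient: "subspace (ambient n)"
  by (simp add: subspace_def ambient_iff lookup_add)

lemma lattice_points_diff: "x \<in> lattice_points n \<Longrightarrow> y \<in> lattice_points n \<Longrightarrow> x - y \<in> lattice_points n"
  using subspace_diff[OF subspace_ambient]
  by (auto simp: lattice_points_iff lookup_minus)

lemma lattice_points_uminus: "x \<in> lattice_points n \<Longrightarrow> - x \<in> lattice_points n"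
  using subspace_neg[OF subspace_ambient]
  by (auto simp: lattice_points_iff)

lemma lattice_points_add: "x \<in> lattice_points n \<Longrightarrow> y \<in> lattice_points n \<Longrightarrow> x + y \<in> lattice_points n"
  using lattice_points_diff[of x n "- y"] lattice_points_uminus by simp

lemma lattice_points_subset: "lattice_points n \<subseteq> ambient n"
  by (auto simp: lattice_points_iff)

lemma real_line_in_lattice [simp]: "(r, 0) \<in> lattice_points n"
  by (simp add: lattice_points_iff ambient_def)

definition standard_vectors :: "nat \<Rightarrow> rvec set" where
  "standard_vectors n = insert (1, 0) ((\<lambda>i. (0, Poly_Mapping.single i 1)) ` {..<n})"

lemma ambient_span: "ambient n \<subseteq> span (standard_vectors n)"
proof
  fix x assume "x \<in> ambient n"
  then have keys: "Poly_Mapping.keys (snd x) \<subseteq> {..<n}" by (auto simp: ambient_def)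
  let ?y = "fst x *\<^sub>R (1, 0) + (\<Sum>i<n. Poly_Mapping.lookup (snd x) i *\<^sub>R (0, Poly_Mapping.single i 1)) :: rvec"
  have "Poly_Mapping.lookup (snd x) j = Poly_Mapping.lookup (snd ?y) j" for j
  proof (cases "j < n")
    case True
    then show ?thesis
      by (simp add: lookup_add snd_sum lookup_sum lookup_single when_def if_distrib cong: if_cong)
  next
    case False
    then have "Poly_Mapping.lookup (snd x) j = 0" using keys by (auto simp: in_keys_iff)
    then show ?thesis using False by (auto simp: lookup_add snd_sum lookup_sum lookup_single when_def)
  qed
  then have "snd x = snd ?y" by (rule poly_mapping_eqI)
  moreover have "fst x = fst ?y" by (simp add: fst_sum)
  ultimately have "x = ?y" by (intro prod_eqI)
  also have "?y \<in> span (standard_vectors n)"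
    by (intro span_add span_scale span_sum span_base) (auto simp: standard_vectors_def)
  finally show "x \<in> span (standard_vectors n)" .
qed

lemma independent_in_ambient_finite:
  assumes "independent B" "B \<subseteq> ambient n" shows "finite B"
  using independent_span_bound[OF _ assms(1), of "standard_vectors n"] assms(2) ambient_span
  by (auto simp: standard_vectors_def)

text \<open>
  Let \<open>w = (1, 0)\<close>. Suppose a coefficient at some \<open>b \<noteq> w\<close> is irrational, and apply to all coordinates in
  \<open>M\<close> an additive map \<open>f\<close> of the reals that kills the integers but not this coefficient. Lattice points have
  integral coordinates there, so this yields a nontrivial real relation among the elements of \<open>B\<close> modulo \<open>w\<close>.
  If it holds exactly, then \<open>B\<close> is dependent; otherwise \<open>w\<close> is in the span of the other elements of \<open>B\<close>,
  which contradicts independence because \<open>w\<close> itself is then in \<open>B\<close>.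
\<close>
lemma coordinates_rational:
  assumes B: "independent B" "B \<subseteq> lattice_points n" and w: "(1, 0) \<in> span B \<Longrightarrow> (1, 0) \<in> B"
    and x: "(\<Sum>b\<in>B. c b *\<^sub>R b) \<in> lattice_points n" and b: "b \<in> B" "b \<noteq> (1, 0)"
  shows "c b \<in> \<rat>"
proof (rule ccontr)
  assume "c b \<notin> \<rat>"
  then obtain f :: "real \<Rightarrow> real" where add: "\<And>s t. f (s + t) = f s + f t" and f1: "f 1 = 0" and fb: "f (c b) = 1"
    by (rule additive_map_killing_one) (rule that; assumption)
  interpret f: additive f by unfold_locales (rule add)
  have fin: "finite B"
    using independent_in_ambient_finite[OF B(1)] B(2) lattice_points_subset by blast
  have f_mult: "f (s * k) = f s * k" if k: "k \<in> \<int>" for s k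
  proof -
    have nat: "f (s * of_nat j) = f s * of_nat j" for j
      by (induction j) (simp_all add: f.zero distrib_left f.add)
    obtain i where i: "k = of_int i" using k by (auto elim: Ints_cases)
    show ?thesis
      by (cases i rule: int_cases2) (use nat i in \<open>auto simp: f.minus\<close>)
  qed
  have f_int: "f k = 0" if "k \<in> \<int>" for k using f_mult[OF that, of 1] f1 by simp
  let ?y = "\<Sum>b\<in>B - {(1, 0)}. f (c b) *\<^sub>R b"
  have "snd ?y = 0"
  proof (rule poly_mapping_eqI)
    fix i
    have "0 = f (Poly_Mapping.lookup (snd (\<Sum>b\<in>B. c b *\<^sub>R b)) i)"
      using x by (intro f_int[symmetric]) (auto simp: lattice_points_iff)
    also have "\<dots> = (\<Sum>b\<in>B. f (c b) * Poly_Mapping.lookup (snd b) i)"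
      unfolding lookup_snd_sum f.sum
      using B(2) by (intro sum.cong refl f_mult) (auto simp: lattice_points_iff)
    also have "\<dots> = Poly_Mapping.lookup (snd ?y) i"
      unfolding lookup_snd_sum using fin by (intro sum.mono_neutral_right) auto
    finally show "Poly_Mapping.lookup (snd ?y) i = Poly_Mapping.lookup 0 i" by simp
  qed
  then have y: "?y = fst ?y *\<^sub>R (1, 0)" by (simp add: prod_eq_iff)
  have sp: "?y \<in> span (B - {(1, 0)})" by (intro span_sum span_scale span_base)
  show False
  proof (cases "fst ?y = 0")
    case True
    with y have "?y = 0" by (simp add: zero_prod_def)
    moreover have "independent (B - {(1, 0)})" using B(1) independent_mono by blast
    ultimately have "f (c b) = 0"
      using independentD[of "B - {(1, 0)}" "B - {(1, 0)}" "\<lambda>b. f (c b)" b] fin b by auto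
    with fb show False by simp
  next
    case False
    have eq: "(1, 0) = inverse (fst ?y) *\<^sub>R ?y" by (subst y) (use False in simp)
    have *: "(1, 0) \<in> span (B - {(1, 0)})"
      by (rule ssubst[OF eq, where P = "\<lambda>z. z \<in> span (B - {(1, 0)})"]) (rule span_scale[OF sp])
    then have "(1, 0) \<in> span B" using span_mono[of "B - {(1, 0)}" B] by blast
    with w have "(1, 0) \<in> B" .
    with * B(1) show False unfolding dependent_def by blast
  qed
qed

text \<open>
  Clearing denominators; the coordinate along the real direction \<open>(1, 0)\<close> is arbitrary.
\<close>
lemma lattice_integral_coordinates:
  assumes B: "independent B" "B \<subseteq> lattice_points n" and w: "(1, 0) \<in> span B \<Longrightarrow> (1, 0) \<in> B"
    and x: "x \<in> lattice_points n" "x \<in> span B"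
  obtains d :: int and m :: "rvec \<Rightarrow> int" and r :: real
  where "d > 0" "(1, 0) \<notin> B \<Longrightarrow> r = 0"
    "of_int d *\<^sub>R x = (\<Sum>b\<in>B - {(1, 0)}. of_int (m b) *\<^sub>R b) + r *\<^sub>R (1, 0)"
proof -
  have fin: "finite B"
    using independent_in_ambient_finite[OF B(1)] B(2) lattice_points_subset by blast
  obtain c where c: "x = (\<Sum>b\<in>B. c b *\<^sub>R b)"
    using x(2) by (auto simp: span_finite[OF fin])
  have rat: "c ` (B - {(1, 0)}) \<subseteq> \<rat>"
    using coordinates_rational[OF B w, of c] x(1) c by auto
  obtain d :: int where d: "d > 0" "\<And>b. b \<in> B - {(1, 0)} \<Longrightarrow> of_int d * c b \<in> \<int>"
    by (rule common_denominator[OF finite_Diff[OF fin] rat]) (rule that; assumption)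
  define m where "m b = \<lfloor>of_int d * c b\<rfloor>" for b
  have m: "of_int (m b) = of_int d * c b" if "b \<in> B - {(1, 0)}" for b
    using d(2)[OF that] by (simp add: m_def)
  define r where "r = (if (1, 0) \<in> B then of_int d * c (1, 0) else 0)"
  have "x = (\<Sum>b\<in>B - {(1, 0)}. c b *\<^sub>R b) + (if (1, 0) \<in> B then c (1, 0) else 0) *\<^sub>R (1, 0)"
    using fin by (auto simp: c sum.remove[of B "(1, 0)"] zero_prod_def)
  then have "of_int d *\<^sub>R x = (\<Sum>b\<in>B - {(1, 0)}. of_int (m b) *\<^sub>R b) + r *\<^sub>R (1, 0)"
    by (simp add: r_def m scaleR_right_distrib scaleR_sum_right)
  with d(1) show ?thesis by (intro that[of d r m]) (auto simp: r_def)
qed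

section \<open>Supporting functionals of total cones\<close>

text \<open>
  Choose a basis \<open>B\<close> of the span of the group out of the group itself, containing \<open>w = (1, 0)\<close> whenever \<open>w\<close>
  lies in \<open>H\<close>. By the integrality of coordinates the sum of the elements of \<open>B\<close>, with signs that put them
  into \<open>K\<close>, is an order unit, and it is not equivalent to \<open>0\<close> because \<open>K\<close> is proper. The resulting
  additive function on the group agrees with the real-linear functional that has the same values on \<open>B\<close>:
  along the elements other than \<open>w\<close> only integral coefficients occur, and along \<open>w\<close> the function is monotone
  on the real line, hence linear.
\<close>
lemma supporting_functional:
  assumes H: "subspace H" and K: "total_cone (H \<inter> lattice_points n) K"
    and ray: "\<And>r. 0 \<le> r \<Longrightarrow> (r, 0) \<in> H \<Longrightarrow> (r, 0) \<in> K"
    and proper: "K \<noteq> H \<inter> lattice_points n"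
  obtains \<phi> :: "rvec \<Rightarrow> real" where "linear \<phi>" "\<exists>x\<in>H \<inter> lattice_points n. \<phi> x \<noteq> 0" "\<And>x. x \<in> K \<Longrightarrow> 0 \<le> \<phi> x"
proof -
  let ?G = "H \<inter> lattice_points n"
  let ?w = "(1, 0) :: rvec"
  have G_diff: "x - y \<in> ?G" if "x \<in> ?G" "y \<in> ?G" for x y
    using that H lattice_points_diff subspace_diff by blast
  have G_zero: "0 \<in> ?G"
    using subspace_0[OF H] real_line_in_lattice[of 0 n] by (simp add: zero_prod_def)
  have G_neg: "- x \<in> ?G" if "x \<in> ?G" for x using G_diff[OF G_zero that] by simp
  have K_add: "x + y \<in> K" if "x \<in> K" "y \<in> K" for x y using total_coneD(2)[OF K that] .
  have K_sub: "K \<subseteq> ?G" using total_coneD(1)[OF K] .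
  have K_zero: "0 \<in> K" using total_coneD(3)[OF K G_zero] by simp
  have K_sum: "sum f A \<in> K" if "\<And>a. a \<in> A \<Longrightarrow> f a \<in> K" for f :: "rvec \<Rightarrow> rvec" and A
    using that by (induction A rule: infinite_finite_induct) (auto intro: K_zero K_add)
  have K_int: "of_int k *\<^sub>R x \<in> K" if "x \<in> K" "0 \<le> k" for k x
  proof -
    have "of_nat j *\<^sub>R x \<in> K" for j
      by (induction j) (auto simp: scaleR_left_distrib intro: K_zero K_add that)
    then show ?thesis using that(2) by (cases k rule: int_cases) auto
  qed
  have line: "(r, 0) \<in> H \<longleftrightarrow> ?w \<in> H" if "r \<noteq> 0" for r
  proof -
    have "(r, 0) = r *\<^sub>R ?w" "?w = inverse r *\<^sub>R (r, 0)" using that by auto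
    then show ?thesis using H subspace_scale by metis
  qed
  have "independent ({?w} \<inter> ?G)"
    by (rule independent_mono[of "{?w}"]) (auto simp: zero_prod_def)
  then obtain B where wB: "{?w} \<inter> ?G \<subseteq> B" and B: "B \<subseteq> ?G" "independent B" "?G \<subseteq> span B"
    using maximal_independent_subset_extend[of "{?w} \<inter> ?G" ?G] by blast
  have fin: "finite B"
    using independent_in_ambient_finite[OF B(2)] B(1) lattice_points_subset by blast
  have "span B \<subseteq> H" using B(1) H by (intro span_minimal) auto
  then have w: "?w \<in> B" if "?w \<in> span B" using that wB by auto
  have w_iff: "?w \<in> B \<longleftrightarrow> ?w \<in> H" using wB B(1) by auto
  have coords: "\<exists>d m r. d > 0 \<and> (?w \<notin> B \<longrightarrow> r = 0) \<and>
      of_int d *\<^sub>R x = (\<Sum>b\<in>B - {?w}. of_int (m b) *\<^sub>R b) + r *\<^sub>R ?w"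
    if x: "x \<in> ?G" for x
  proof -
    have *: "B \<subseteq> lattice_points n" "x \<in> lattice_points n" "x \<in> span B" using x B by auto
    show ?thesis by (rule lattice_integral_coordinates[OF B(2) *(1) w *(2,3)]) blast+
  qed
  define s where "s b = (if b \<in> K then b else - b)" for b
  have s: "s b \<in> K" if "b \<in> B" for b
    using that B(1) total_coneD(3)[OF K, of b] by (auto simp: s_def)
  define e where "e = sum s B"
  have eK: "e \<in> K" unfolding e_def by (rule K_sum) (rule s)
  have bound: "\<exists>N d. d > 0 \<and> of_int N *\<^sub>R e - of_int d *\<^sub>R x \<in> K" if x: "x \<in> ?G" for x
  proof -
    obtain d m r where d: "d > 0" "?w \<notin> B \<longrightarrow> r = 0"
      "of_int d *\<^sub>R x = (\<Sum>b\<in>B - {?w}. of_int (m b) *\<^sub>R b) + r *\<^sub>R ?w"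
      using coords[OF x] by blast
    \<comment> \<open>A bound for all coordinates of \<open>d x\<close> at once, so that every summand of \<open>N e - d x\<close> lies in \<open>K\<close>.\<close>
    define N where "N = (\<Sum>b\<in>B. \<bar>m b\<bar>) + \<lceil>\<bar>r\<bar>\<rceil>"
    have N_r: "\<bar>r\<bar> \<le> of_int N"
    proof -
      have "0 \<le> (\<Sum>b\<in>B. \<bar>m b\<bar>)" by (rule sum_nonneg) auto
      then have "\<lceil>\<bar>r\<bar>\<rceil> \<le> N" by (simp add: N_def)
      then show ?thesis by linarith
    qed
    have N_m: "\<bar>m b\<bar> \<le> N" if "b \<in> B" for b
    proof -
      have "\<bar>m b\<bar> \<le> (\<Sum>b\<in>B. \<bar>m b\<bar>)" by (rule member_le_sum) (use that fin in auto)
      moreover have "0 \<le> \<lceil>\<bar>r\<bar>\<rceil>" by linarith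
      ultimately show ?thesis unfolding N_def by linarith
    qed
    have summand: "of_int N *\<^sub>R s b - of_int (m b) *\<^sub>R b \<in> K" if b: "b \<in> B" for b
    proof (cases "b \<in> K")
      case True
      then have "of_int (N - m b) *\<^sub>R s b \<in> K" using N_m[OF b] s[OF b] by (intro K_int) auto
      then show ?thesis using True by (simp add: s_def algebra_simps)
    next
      case False
      then have "of_int (N + m b) *\<^sub>R s b \<in> K" using N_m[OF b] s[OF b] by (intro K_int) auto
      then show ?thesis using False by (simp add: s_def algebra_simps)
    qed
    have w_term: "(if ?w \<in> B then of_int N *\<^sub>R s ?w else 0) - r *\<^sub>R ?w \<in> K"
    proof (cases "?w \<in> B")
      case True
      then have "s ?w = ?w" using ray[of 1] w_iff by (simp add: s_def)
      moreover have "(of_int N - r, 0) \<in> H" using line[of "of_int N - r"] True w_iff subspace_0[OF H]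
        by (cases "of_int N - r = 0") (auto simp: zero_prod_def)
      ultimately show ?thesis using True ray[of "of_int N - r"] N_r by simp
    qed (use d(2) K_zero in \<open>simp del: scaleR_Pair\<close>)
    have "of_int N *\<^sub>R e - of_int d *\<^sub>R x
        = (\<Sum>b\<in>B - {?w}. of_int N *\<^sub>R s b - of_int (m b) *\<^sub>R b)
          + ((if ?w \<in> B then of_int N *\<^sub>R s ?w else 0) - r *\<^sub>R ?w)"
      unfolding d(3) e_def using fin
      by (cases "?w \<in> B")
        (simp_all add: sum.remove[of B ?w] sum_subtractf scaleR_sum_right scaleR_right_distrib
          del: scaleR_Pair)
    also have "\<dots> \<in> K" by (intro K_add K_sum w_term summand) auto
    finally show ?thesis using d(1) by blast
  qed
  \<comment> \<open>Otherwise every element would be bounded by a multiple of \<open>e\<close>, hence by \<open>0\<close>.\<close>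
  have e_neg: "- e \<notin> K"
  proof
    assume neg: "- e \<in> K"
    have "x \<in> K" if x: "x \<in> ?G" for x
    proof (rule ccontr)
      assume "x \<notin> K"
      obtain N d where d: "d > 0" "of_int N *\<^sub>R e - of_int d *\<^sub>R (- x) \<in> K"
        using bound[OF G_neg[OF x]] by blast
      have "of_int (- N) *\<^sub>R e \<in> K"
        using K_int[OF eK, of "- N"] K_int[OF neg, of N] by (cases "0 \<le> N") auto
      then have "of_int (- N) *\<^sub>R e + (of_int N *\<^sub>R e - of_int d *\<^sub>R (- x)) \<in> K"
        using d(2) K_add by blast
      then have "of_int d *\<^sub>R x \<in> K" by simp
      moreover have "of_int (d - 1) *\<^sub>R (- x) \<in> K"
        using \<open>x \<notin> K\<close> total_coneD(3)[OF K x] d(1) by (intro K_int) auto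
      ultimately have "of_int d *\<^sub>R x + of_int (d - 1) *\<^sub>R (- x) \<in> K" by (rule K_add)
      then show False using \<open>x \<notin> K\<close> by (simp add: scaleR_left_diff_distrib)
    qed
    with K_sub proper show False by blast
  qed
  interpret order_unit_cone ?G K e
    by unfold_locales (fact G_diff K eK e_neg bound)+
  obtain \<phi> :: "rvec \<Rightarrow> real" where \<phi>: "linear \<phi>" "\<forall>b\<in>B. \<phi> b = slope b"
    using linear_independent_extend[OF B(2)] by blast
  interpret \<phi>: linear \<phi> by (fact \<phi>(1))
  have line_slope: "slope (r *\<^sub>R ?w) = r * slope ?w" if wH: "?w \<in> H" for r
  proof -
    have rG: "(t, 0) \<in> ?G" for t using line[of t] wH G_zero by (cases "t = 0") (auto simp: zero_prod_def)
    \<comment> \<open>A monotone additive function on the real line is linear: squeeze \<open>q r\<close> between consecutive integers.\<close>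
    define f where "f t = slope (t, 0)" for t
    have f_add: "f (t + u) = f t + f u" for t u
      using slope_add[OF rG rG, of t u] by (simp add: f_def)
    interpret f: additive f by unfold_locales (rule f_add)
    have f_nonneg: "0 \<le> f t" if "0 \<le> t" for t
      using ray[OF that] rG slope_nonneg by (auto simp: f_def)
    have f_mono: "f t \<le> f u" if "t \<le> u" for t u
      using f_nonneg[of "u - t"] that f.diff[of u t] by simp
    have f_int: "f (of_int k * t) = of_int k * f t" for k t
      using slope_int[OF rG, of k t] by (simp add: f_def)
    have small: "of_int q * \<bar>f r - r * f 1\<bar> \<le> f 1" if q: "0 < q" for q :: int
    proof -
      define k where "k = \<lfloor>of_int q * r\<rfloor>"
      have k: "of_int k \<le> of_int q * r" "of_int q * r \<le> of_int (k + 1)" unfolding k_def by linarith+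
      have "of_int k * f 1 \<le> of_int q * f r" "of_int q * f r \<le> of_int (k + 1) * f 1"
        using f_mono[OF k(1)] f_mono[OF k(2)] f_int[of k 1] f_int[of "k + 1" 1] f_int[of q r] by auto
      moreover have "of_int k * f 1 \<le> of_int q * r * f 1" "of_int q * r * f 1 \<le> of_int (k + 1) * f 1"
        using k f_nonneg[of 1] by (auto intro!: mult_right_mono)
      ultimately have "\<bar>of_int q * f r - of_int q * r * f 1\<bar> \<le> f 1"
        by (simp add: abs_le_iff distrib_right)
      then have "\<bar>of_int q * (f r - r * f 1)\<bar> \<le> f 1" by (simp add: algebra_simps)
      then show ?thesis using q by (simp add: abs_mult)
    qed
    have "f r = r * f 1"
    proof (rule ccontr)
      assume "f r \<noteq> r * f 1"
      then have "0 < \<bar>f r - r * f 1\<bar>" by simp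
      then obtain j where j: "f 1 < real j * \<bar>f r - r * f 1\<bar>"
        using reals_Archimedean3 by blast
      then have "0 < int j" using f_nonneg[of 1] by (cases j) auto
      from small[OF this] j show False by simp
    qed
    then show ?thesis by (simp add: f_def)
  qed
  have slope_sum: "slope (sum f A) = (\<Sum>a\<in>A. slope (f a)) \<and> sum f A \<in> ?G"
    if "finite A" "\<And>a. a \<in> A \<Longrightarrow> f a \<in> ?G" for f :: "rvec \<Rightarrow> rvec" and A
    using that
  proof (induction A)
    case empty
    show ?case using slope_int[OF G_zero, of 0] G_zero by simp
  next
    case (insert a A)
    then show ?case using slope_add[of "f a" "sum f A"] G_closed(3)[of "f a" "sum f A"] by simp
  qed
  have agree: "\<phi> x = slope x" if x: "x \<in> ?G" for x
  proof -
    obtain d m r where d: "d > 0" "?w \<notin> B \<longrightarrow> r = 0"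
      "of_int d *\<^sub>R x = (\<Sum>b\<in>B - {?w}. of_int (m b) *\<^sub>R b) + r *\<^sub>R ?w"
      using coords[OF x] by blast
    let ?S = "\<Sum>b\<in>B - {?w}. of_int (m b) *\<^sub>R b"
    have BG: "of_int (m b) *\<^sub>R b \<in> ?G" if "b \<in> B - {?w}" for b
      using that B(1) by (intro G_int) auto
    have S: "slope ?S = (\<Sum>b\<in>B - {?w}. slope (of_int (m b) *\<^sub>R b))" "?S \<in> ?G"
      using slope_sum[of "B - {?w}" "\<lambda>b. of_int (m b) *\<^sub>R b"] fin BG by auto
    have r: "r *\<^sub>R ?w \<in> ?G" "slope (r *\<^sub>R ?w) = \<phi> (r *\<^sub>R ?w)"
    proof -
      have "slope 0 = 0" using slope_int[OF G_zero, of 0] by simp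
      then have "r *\<^sub>R ?w \<in> ?G \<and> slope (r *\<^sub>R ?w) = \<phi> (r *\<^sub>R ?w)"
      proof (cases "?w \<in> B")
        case True
        then have "?w \<in> H" using w_iff by simp
        moreover have "r *\<^sub>R ?w \<in> lattice_points n" by simp
        ultimately show ?thesis
          using line_slope[of r] \<phi>(2) True subspace_scale[OF H, of ?w r]
          by (auto simp: \<phi>.scaleR simp del: scaleR_Pair)
      next
        case False
        then show ?thesis using d(2) G_zero \<phi>.zero \<open>slope 0 = 0\<close> by (simp del: scaleR_Pair)
      qed
      then show "r *\<^sub>R ?w \<in> ?G" "slope (r *\<^sub>R ?w) = \<phi> (r *\<^sub>R ?w)" by auto
    qed
    have "of_int d * slope x = slope ?S + slope (r *\<^sub>R ?w)"
      using slope_int[OF x, of d] slope_add[OF S(2) r(1)] d(3) by simp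
    also have "slope ?S = (\<Sum>b\<in>B - {?w}. of_int (m b) * slope b)"
      unfolding S(1) using B(1) by (intro sum.cong refl slope_int) auto
    also have "\<dots> = \<phi> ?S"
      using \<phi>(2) by (simp add: \<phi>.sum \<phi>.scaleR)
    also have "\<phi> ?S + slope (r *\<^sub>R ?w) = of_int d * \<phi> x"
      unfolding r(2) \<phi>.add[symmetric] d(3)[symmetric] by (simp add: \<phi>.scaleR)
    finally show ?thesis using d(1) by simp
  qed
  show ?thesis
  proof (rule that[OF \<phi>(1)])
    have "e \<in> ?G" using eK K_sub by blast
    moreover have "\<phi> e \<noteq> 0" using agree[OF calculation] slope_unit by simp
    ultimately show "\<exists>x\<in>?G. \<phi> x \<noteq> 0" by blast
    show "0 \<le> \<phi> x" if "x \<in> K" for x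
      using agree[OF subsetD[OF K_sub that]] slope_nonneg[OF that] by simp
  qed
qed

section \<open>Flags as iterated extensions\<close>

definition last_space :: "nat \<Rightarrow> flag \<Rightarrow> rvec set" where
  "last_space n F = flag_space n F (length F)"

text \<open>
  The space in which the next member of the flag is a hyperplane.
\<close>
definition rational_part :: "nat \<Rightarrow> flag \<Rightarrow> rvec set" where
  "rational_part n F = span (last_space n F \<inter> lattice_points n)"

definition pos_part :: "flag \<Rightarrow> rvec set" where
  "pos_part F = (\<Union>i\<in>{1..length F}. flag_pos F i)"

text \<open>
  Every flag arises by iterating this step, with the orientation absorbed into the sign of \<open>\<phi>\<close>.
\<close>
definition extend_flag :: "nat \<Rightarrow> flag \<Rightarrow> (rvec \<Rightarrow> real) \<Rightarrow> flag" where
  "extend_flag n F \<phi> = F @ [({x \<in> rational_part n F. \<phi> x = 0}, {x \<in> rational_part n F. 0 < \<phi> x})]"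

lemma flag_cone_eq: "flag_cone n F = pos_part F \<union> last_space n F"
  by (simp add: flag_cone_def pos_part_def last_space_def)

lemma flag_space_append: "i \<le> length F \<Longrightarrow> flag_space n (F @ R) i = flag_space n F i"
  by (auto simp: flag_space_def nth_append)

lemma flag_pos_append: "1 \<le> i \<Longrightarrow> i \<le> length F \<Longrightarrow> flag_pos (F @ R) i = flag_pos F i"
  by (auto simp: flag_pos_def nth_append)

lemma last_space_snoc [simp]: "last_space n (F @ [x]) = fst x"
  by (simp add: last_space_def flag_space_def)

lemma last_space_Nil [simp]: "last_space n [] = ambient n"
  by (simp add: last_space_def flag_space_def)

lemma pos_part_Nil [simp]: "pos_part [] = {}"
  by (simp add: pos_part_def)

lemma pos_part_snoc [simp]: "pos_part (F @ [x]) = pos_part F \<union> snd x"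
proof -
  have "{1..length (F @ [x])} = insert (Suc (length F)) {1..length F}" by auto
  moreover have "flag_pos (F @ [x]) (Suc (length F)) = snd x" by (simp add: flag_pos_def)
  ultimately show ?thesis by (simp add: pos_part_def flag_pos_append Un_commute)
qed

lemma pos_part_append: "pos_part F \<subseteq> pos_part (F @ R)"
  by (induction R rule: rev_induct) (auto simp flip: append_assoc)

lemma oriented_hyperplaneE:
  assumes "oriented_hyperplane V H Hpos"
  obtains \<phi> :: "rvec \<Rightarrow> real" where "linear \<phi>" "\<exists>x\<in>V. \<phi> x \<noteq> 0" "H = {x \<in> V. \<phi> x = 0}" "Hpos = {x \<in> V. 0 < \<phi> x}"
proof -
  obtain \<phi> :: "rvec \<Rightarrow> real" where \<phi>: "linear \<phi>" "\<exists>x\<in>V. \<phi> x \<noteq> 0" "H = {x \<in> V. \<phi> x = 0}"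
    and "Hpos = {x \<in> V. \<phi> x > 0} \<or> Hpos = {x \<in> V. \<phi> x < 0}"
    using assms unfolding oriented_hyperplane_def by blast
  then consider "Hpos = {x \<in> V. 0 < \<phi> x}" | "Hpos = {x \<in> V. \<phi> x < 0}" by blast
  then show ?thesis
  proof cases
    case 1
    with \<phi> show ?thesis by (intro that[of \<phi>]) auto
  next
    case 2
    with \<phi> show ?thesis by (intro that[of "\<lambda>x. - \<phi> x"] linear_compose_neg) auto
  qed
qed

lemma subspace_kernel: "linear \<phi> \<Longrightarrow> subspace {x \<in> span S. \<phi> x = (0::real)}"
  by (auto simp: subspace_def linear_0 linear_add linear_scale span_zero span_add span_scale)

text \<open>
  The conditions on the individual members of a flag, without the condition on the cone. They can be checked
  one member at a time, whereas the cone shrinks with each step.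
\<close>
definition flag_steps :: "nat \<Rightarrow> flag \<Rightarrow> bool" where
  "flag_steps n F \<longleftrightarrow> (\<forall>i\<in>{1..length F}.
     subspace (flag_space n F i) \<and> flag_space n F i \<subset> flag_space n F (i - 1) \<and>
     oriented_hyperplane (span (flag_space n F (i - 1) \<inter> lattice_points n))
       (flag_space n F i) (flag_pos F i))"

lemma flag_steps_snoc:
  "flag_steps n (F @ [x]) \<longleftrightarrow> flag_steps n F \<and> subspace (fst x) \<and> fst x \<subset> last_space n F \<and>
     oriented_hyperplane (rational_part n F) (fst x) (snd x)"
proof -
  have "{1..length (F @ [x])} = insert (Suc (length F)) {1..length F}" by auto
  moreover have "flag_space n (F @ [x]) (Suc (length F)) = fst x" "flag_pos (F @ [x]) (Suc (length F)) = snd x"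
    by (simp_all add: flag_space_def flag_pos_def)
  moreover have "flag_space n (F @ [x]) i = flag_space n F i" "flag_space n (F @ [x]) (i - 1) = flag_space n F (i - 1)"
    "flag_pos (F @ [x]) i = flag_pos F i" if "i \<in> {1..length F}" for i
    using that by (auto simp: flag_space_append flag_pos_append)
  moreover have "flag_space n (F @ [x]) (length F) = last_space n F"
    by (simp add: flag_space_append last_space_def)
  ultimately show ?thesis
    unfolding flag_steps_def rational_part_def by auto
qed

lemma is_flag_iff: "is_flag n F \<longleftrightarrow> flag_steps n F \<and> {0..} \<times> {0} \<subseteq> flag_cone n F"
  by (simp add: is_flag_def flag_steps_def)

lemma flag_steps_subspace: "flag_steps n F \<Longrightarrow> subspace (last_space n F)"
  by (cases F rule: rev_cases) (auto simp: flag_steps_snoc subspace_ambient)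

lemma flag_steps_rational_part: "flag_steps n F \<Longrightarrow> rational_part n F \<subseteq> last_space n F"
  unfolding rational_part_def using flag_steps_subspace by (intro span_minimal) auto

lemma oriented_hyperplane_subset: "oriented_hyperplane V H Hpos \<Longrightarrow> H \<subseteq> V \<and> Hpos \<subseteq> V"
  unfolding oriented_hyperplane_def by auto

lemma flag_cone_snoc_subset: "flag_steps n (F @ [x]) \<Longrightarrow> flag_cone n (F @ [x]) \<subseteq> flag_cone n F"
  using flag_steps_rational_part[of n F] oriented_hyperplane_subset
  by (fastforce simp: flag_steps_snoc flag_cone_eq)

lemma is_flag_snocE:
  assumes "is_flag n (F @ [x])"
  obtains \<phi> where "is_flag n F" "linear \<phi>" "\<exists>x\<in>rational_part n F. \<phi> x \<noteq> 0"
    "F @ [x] = extend_flag n F \<phi>"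
proof -
  have steps: "flag_steps n (F @ [x])" using assms by (simp add: is_flag_iff)
  then have "oriented_hyperplane (rational_part n F) (fst x) (snd x)"
    by (simp add: flag_steps_snoc)
  then obtain \<phi> where "linear \<phi>" "\<exists>x\<in>rational_part n F. \<phi> x \<noteq> 0" "F @ [x] = extend_flag n F \<phi>"
    by (elim oriented_hyperplaneE) (auto simp: extend_flag_def prod_eq_iff)
  moreover have "is_flag n F"
    using assms steps flag_cone_snoc_subset[OF steps] by (auto simp: is_flag_iff flag_steps_snoc)
  ultimately show ?thesis using that by blast
qed

lemma last_space_extend [simp]: "last_space n (extend_flag n F \<phi>) = {x \<in> rational_part n F. \<phi> x = 0}"
  by (simp add: extend_flag_def)

lemma pos_part_extend [simp]: "pos_part (extend_flag n F \<phi>) = pos_part F \<union> {x \<in> rational_part n F. 0 < \<phi> x}"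
  by (simp add: extend_flag_def)

text \<open>
  The ray of nonnegative scalars lies in the old cone; any part of it outside the open half-spaces is in the
  last space, and there the sign of \<open>\<phi>\<close> decides.
\<close>
lemma is_flag_extend:
  assumes F: "is_flag n F" and \<phi>: "linear \<phi>" "\<exists>x\<in>rational_part n F. \<phi> x \<noteq> 0"
    and ray: "\<And>r. 0 \<le> r \<Longrightarrow> (r, 0) \<in> rational_part n F \<Longrightarrow> 0 \<le> \<phi> (r, 0)"
  shows "is_flag n (extend_flag n F \<phi>)"
proof -
  have steps: "flag_steps n F" using F by (simp add: is_flag_iff)
  have sub: "rational_part n F \<subseteq> last_space n F" using flag_steps_rational_part[OF steps] .
  have "oriented_hyperplane (rational_part n F) {x \<in> rational_part n F. \<phi> x = 0} {x \<in> rational_part n F. 0 < \<phi> x}"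
    using \<phi> unfolding oriented_hyperplane_def by blast
  moreover have "subspace {x \<in> rational_part n F. \<phi> x = 0}"
    unfolding rational_part_def by (rule subspace_kernel[OF \<phi>(1)])
  moreover have "{x \<in> rational_part n F. \<phi> x = 0} \<subset> last_space n F"
    using sub \<phi>(2) by blast
  ultimately have "flag_steps n (extend_flag n F \<phi>)"
    using steps by (simp add: extend_flag_def flag_steps_snoc)
  moreover have "(r, 0) \<in> flag_cone n (extend_flag n F \<phi>)" if r: "0 \<le> r" for r
  proof (cases "(r, 0) \<in> pos_part F")
    case False
    with F r have "(r, 0) \<in> last_space n F" by (auto simp: is_flag_iff flag_cone_eq)
    then have "(r, 0) \<in> rational_part n F" by (auto simp: rational_part_def intro: span_base)
    with ray[OF r] show ?thesis by (auto simp: flag_cone_eq)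
  qed (simp add: flag_cone_eq)
  ultimately show ?thesis by (auto simp: is_flag_iff)
qed

lemma is_flag_Nil: "is_flag n []"
  by (auto simp: is_flag_iff flag_steps_def flag_cone_eq ambient_def)

lemma flag_induct [consumes 1, case_names Nil extend]:
  assumes "is_flag n F" and "P []"
    and "\<And>F \<phi>. is_flag n F \<Longrightarrow> P F \<Longrightarrow> linear \<phi> \<Longrightarrow> \<exists>x\<in>rational_part n F. \<phi> x \<noteq> 0 \<Longrightarrow>
      is_flag n (extend_flag n F \<phi>) \<Longrightarrow> P (extend_flag n F \<phi>)"
  shows "P F"
  using assms(1)
proof (induction F rule: rev_induct)
  case (snoc x F)
  then show ?case using assms(3) by (metis is_flag_snocE)
qed (rule assms(2))

lemma is_flag_appendD: "is_flag n (F @ R) \<Longrightarrow> is_flag n F \<and> flag_cone n (F @ R) \<subseteq> flag_cone n F"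
proof (induction R rule: rev_induct)
  case (snoc x R)
  then have F: "is_flag n ((F @ R) @ [x])" by simp
  then have "is_flag n (F @ R)" by (elim is_flag_snocE)
  moreover have "flag_cone n ((F @ R) @ [x]) \<subseteq> flag_cone n (F @ R)"
    using F unfolding is_flag_iff by (intro flag_cone_snoc_subset) (elim conjE)
  ultimately show ?case using snoc.IH by auto
qed simp

lemma flag_rational_part: "is_flag n F \<Longrightarrow> rational_part n F \<subseteq> last_space n F"
  using flag_steps_rational_part by (simp add: is_flag_iff)

lemma flag_subspace: "is_flag n F \<Longrightarrow> subspace (last_space n F)"
  using flag_steps_subspace by (simp add: is_flag_iff)

lemma rational_part_lattice: "x \<in> last_space n F \<Longrightarrow> x \<in> lattice_points n \<Longrightarrow> x \<in> rational_part n F"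
  unfolding rational_part_def by (simp add: span_base)

lemma rational_part_subset: "rational_part n F \<subseteq> ambient n"
  unfolding rational_part_def using lattice_points_subset subspace_ambient
  by (intro span_minimal) auto

section \<open>Flags and total cones\<close>

lemma pos_part_disjoint: "is_flag n F \<Longrightarrow> pos_part F \<inter> last_space n F = {}"
  by (induction rule: flag_induct) (use flag_rational_part in auto)

text \<open>
  The cone is a lexicographic positive cone: the summand that leaves the flag first decides the sign.
\<close>
lemma pos_part_add:
  assumes "is_flag n F"
  shows "x \<in> pos_part F \<Longrightarrow> y \<in> flag_cone n F \<Longrightarrow> x + y \<in> pos_part F"
  using assms
proof (induction arbitrary: x y rule: flag_induct)
  case (extend F \<phi>)
  have sub: "rational_part n F \<subseteq> flag_cone n F" using flag_rational_part[OF extend(1)] by (auto simp: flag_cone_eq)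
  show ?case
  proof (cases "x \<in> pos_part F")
    case True
    then show ?thesis using extend.IH[of x y] extend.prems(2) sub by (auto simp: flag_cone_eq)
  next
    case False
    then have x: "x \<in> rational_part n F" "0 < \<phi> x" using extend.prems(1) by auto
    show ?thesis
    proof (cases "y \<in> pos_part F")
      case True
      then show ?thesis using extend.IH[of y x] x sub by (auto simp: add.commute)
    next
      case False
      then have "y \<in> rational_part n F" "0 \<le> \<phi> y" using extend.prems(2) by (auto simp: flag_cone_eq)
      with x show ?thesis
        using extend(2) by (auto simp: linear_add rational_part_def span_add)
    qed
  qed
qed simp

lemma flag_cone_total:
  assumes "is_flag n F" "x \<in> lattice_points n"
  shows "x \<in> flag_cone n F \<or> - x \<in> flag_cone n F"
  using assms(1)
proof (induction rule: flag_induct)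
  case Nil
  show ?case using assms(2) lattice_points_subset by (auto simp: flag_cone_eq)
next
  case (extend F \<phi>)
  show ?case
  proof (cases "x \<in> pos_part F \<or> - x \<in> pos_part F")
    case False
    with extend.IH have "x \<in> last_space n F \<or> - x \<in> last_space n F" by (auto simp: flag_cone_eq)
    then have "x \<in> last_space n F" "- x \<in> last_space n F"
      using subspace_neg[OF flag_subspace[OF extend(1)], of x]
        subspace_neg[OF flag_subspace[OF extend(1)], of "- x"] by auto
    then have "x \<in> rational_part n F" "- x \<in> rational_part n F"
      using assms(2) lattice_points_uminus rational_part_lattice by blast+
    then show ?thesis using linear_neg[OF extend(2), of x] by (cases "\<phi> x" "0::real" rule: linorder_cases) (auto simp: flag_cone_eq)
  qed (auto simp: flag_cone_eq)
qed

lemma total_flag_cone: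
  assumes F: "is_flag n F"
  shows "total_cone (lattice_points n) (flag_cone n F \<inter> lattice_points n)"
proof -
  have "x + y \<in> flag_cone n F" if "x \<in> flag_cone n F" "y \<in> flag_cone n F" for x y
    using that pos_part_add[OF F, of x y] pos_part_add[OF F, of y x] subspace_add[OF flag_subspace[OF F], of x y]
    by (auto simp: flag_cone_eq add.commute)
  then show ?thesis
    using flag_cone_total[OF F] lattice_points_add lattice_points_uminus unfolding total_cone_def by blast
qed

text \<open>
  The integral multiples of a point \<open>g\<close> with \<open>\<phi> g > 0\<close> approximate any ratio of values of \<open>\<phi>\<close>, so the
  values of \<open>\<psi>\<close> are squeezed.
\<close>
lemma proportional_functionals:
  fixes \<phi> \<psi> :: "'a::real_vector \<Rightarrow> real"
  assumes lin: "linear \<phi>" "linear \<psi>" and G: "\<And>x y. x \<in> G \<Longrightarrow> y \<in> G \<Longrightarrow> x - y \<in> G"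
    and sgn: "\<And>x. x \<in> G \<Longrightarrow> 0 < \<phi> x \<Longrightarrow> 0 \<le> \<psi> x"
    and nz: "\<exists>x\<in>span G. \<phi> x \<noteq> 0" "\<exists>x\<in>span G. \<psi> x \<noteq> 0"
  obtains c where "0 < c" "\<And>x. x \<in> span G \<Longrightarrow> \<psi> x = c * \<phi> x"
proof -
  interpret \<phi>: linear \<phi> by (fact lin(1))
  interpret \<psi>: linear \<psi> by (fact lin(2))
  have G0: "0 \<in> G" if "x \<in> G" for x using G[OF that that] by simp
  have G_neg: "- x \<in> G" if "x \<in> G" for x using G[OF G0[OF that] that] by simp
  have G_int: "of_int k *\<^sub>R x \<in> G" if x: "x \<in> G" for k x
  proof -
    have "of_nat j *\<^sub>R x \<in> G" for j
    proof (induction j)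
      case (Suc j)
      then show ?case using G[OF Suc G_neg[OF x]] by (simp add: scaleR_left_distrib algebra_simps)
    qed (use G0[OF x] in simp)
    from this[of "nat \<bar>k\<bar>"] G_neg show ?thesis by (cases "0 \<le> k") force+
  qed
  have "\<exists>x\<in>G. \<phi> x \<noteq> 0"
  proof (rule ccontr)
    assume "\<not> (\<exists>x\<in>G. \<phi> x \<noteq> 0)"
    then have "\<phi> x = 0" if "x \<in> span G" for x
      using linear_eq_on_span[OF lin(1) linear_zero, of G x] that by auto
    with nz(1) show False by blast
  qed
  then obtain x where "x \<in> G" "\<phi> x \<noteq> 0" by blast
  then obtain g where g: "g \<in> G" "0 < \<phi> g"
    using G_neg[of x] \<phi>.neg[of x] by (metis neg_0_less_iff_less linorder_neqE_linordered_idom)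
  have \<psi>g: "0 \<le> \<psi> g" using sgn[OF g] .
  define c where "c = \<psi> g / \<phi> g"
  have ge: "c * \<phi> x \<le> \<psi> x" if x: "x \<in> G" for x
  proof (rule ccontr)
    assume "\<not> c * \<phi> x \<le> \<psi> x"
    then have "0 < c * \<phi> x - \<psi> x" by simp
    then obtain q where q: "\<psi> g < real q * (c * \<phi> x - \<psi> x)" using reals_Archimedean3 by blast
    \<comment> \<open>The largest \<open>p\<close> with \<open>\<phi> (q x - p g) > 0\<close>; by the choice of \<open>q\<close> it makes \<open>\<psi> (q x - p g)\<close> negative.\<close>
    define p where "p = \<lceil>real q * (\<phi> x / \<phi> g)\<rceil> - 1"
    have p: "of_int p < real q * (\<phi> x / \<phi> g)" "real q * (\<phi> x / \<phi> g) - 1 \<le> of_int p"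
      unfolding p_def by linarith+
    let ?y = "of_int (int q) *\<^sub>R x - of_int p *\<^sub>R g"
    have "of_int p * \<phi> g < real q * \<phi> x" using p(1) g(2) by (simp add: field_simps)
    then have "0 < \<phi> ?y" by (simp add: \<phi>.diff \<phi>.scaleR)
    then have "0 \<le> \<psi> ?y" using sgn G G_int x g(1) by blast
    then have "of_int p * \<psi> g \<le> real q * \<psi> x" by (simp add: \<psi>.diff \<psi>.scaleR)
    moreover have "(real q * (\<phi> x / \<phi> g) - 1) * \<psi> g \<le> of_int p * \<psi> g"
      using p(2) \<psi>g by (rule mult_right_mono)
    ultimately show False using q by (simp add: c_def algebra_simps)
  qed
  have "\<psi> x = c * \<phi> x" if "x \<in> G" for x
    using ge[OF that] ge[OF G_neg[OF that]] by (simp add: \<phi>.neg \<psi>.neg)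
  then have eq: "\<psi> x = c * \<phi> x" if "x \<in> span G" for x
    using linear_eq_on_span[OF lin(2) linear_compose_scale_right[OF lin(1), of c], of G x] that by simp
  have "c \<noteq> 0" using eq nz(2) by auto
  moreover have "0 \<le> c" using \<psi>g g(2) by (simp add: c_def)
  ultimately show ?thesis using eq by (intro that[of c]) auto
qed

text \<open>
  Let \<open>G\<close> be \<open>F2\<close> without its last step. Its cone is larger, so inductively it is an initial segment of \<open>F1\<close>.
  Let \<open>\<psi>\<close> be the functional of the last step. It is nonnegative on the lattice points of the
  last space of \<open>G\<close> that lie in the cone of \<open>F1\<close>. These cannot be all lattice points, so \<open>F1\<close> has a further
  step with a functional \<open>\<phi>\<close>; and \<open>\<psi>\<close> is nonnegative wherever \<open>\<phi>\<close> is positive, so that both are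
  proportional and define the same step.
\<close>
lemma flag_append_if_cone_subset:
  assumes F1: "is_flag n F1" and F2: "is_flag n F2"
    and sub: "flag_cone n F1 \<inter> lattice_points n \<subseteq> flag_cone n F2"
  shows "\<exists>R. F1 = F2 @ R"
  using F2 sub
proof (induction rule: flag_induct)
  case (extend G \<psi>)
  let ?V = "rational_part n G"
  let ?L = "last_space n G \<inter> lattice_points n"
  have "flag_cone n (extend_flag n G \<psi>) \<subseteq> flag_cone n G"
    using is_flag_appendD extend(4) unfolding extend_flag_def by blast
  then obtain R where R: "F1 = G @ R" using extend.IH extend.prems by blast
  have \<psi>_nonneg: "0 \<le> \<psi> x" if "x \<in> ?L" "x \<in> flag_cone n F1" for x
    using that extend.prems pos_part_disjoint[OF extend(1)] by (auto simp: flag_cone_eq)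
  have L_diff: "x - y \<in> ?L" if "x \<in> ?L" "y \<in> ?L" for x y
    using that subspace_diff[OF flag_subspace[OF extend(1)]] lattice_points_diff by blast
  have "R \<noteq> []"
  proof
    assume "R = []"
    then have "?L \<subseteq> flag_cone n F1" using R by (auto simp: flag_cone_eq)
    then have nonneg: "0 \<le> \<psi> x" if "x \<in> ?L" for x using \<psi>_nonneg that by blast
    have "\<psi> x = 0" if x: "x \<in> ?L" for x
    proof -
      have "x - x - x \<in> ?L" using L_diff x by blast
      then show ?thesis using nonneg[OF x] nonneg[of "x - x - x"] linear_neg[OF extend(2), of x] by simp
    qed
    then have "\<psi> x = 0" if "x \<in> ?V" for x
      using linear_eq_on_span[OF extend(2) linear_zero, of ?L x] that by (auto simp: rational_part_def)
    with extend(3) show False by blast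
  qed
  then obtain y R' where R': "R = y # R'" by (cases R) auto
  then have "is_flag n (G @ [y])" using is_flag_appendD[of n "G @ [y]" R'] F1 R by simp
  then obtain \<phi> where \<phi>: "linear \<phi>" "\<exists>x\<in>?V. \<phi> x \<noteq> 0" "G @ [y] = extend_flag n G \<phi>"
    by (rule is_flag_snocE)
  have F1_eq: "F1 = extend_flag n G \<phi> @ R'" using R R' \<phi>(3)[symmetric] by simp
  have sgn: "0 \<le> \<psi> x" if x: "x \<in> ?L" "0 < \<phi> x" for x
  proof -
    have "x \<in> pos_part (extend_flag n G \<phi>)" using x rational_part_lattice by auto
    then have "x \<in> flag_cone n F1"
      unfolding F1_eq flag_cone_eq using pos_part_append by blast
    then show ?thesis using \<psi>_nonneg x by blast
  qed
  obtain c where c: "0 < c" "\<And>x. x \<in> span ?L \<Longrightarrow> \<psi> x = c * \<phi> x"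
    by (rule proportional_functionals[OF \<phi>(1) extend(2) L_diff sgn])
      (use \<phi>(2) extend(3) in \<open>auto simp: rational_part_def\<close>)
  have "extend_flag n G \<psi> = extend_flag n G \<phi>"
    using c by (auto simp: extend_flag_def rational_part_def zero_less_mult_iff)
  with F1_eq show ?case by (intro exI[of _ R']) simp
qed simp

lemma flag_cone_inj:
  assumes "is_flag n F1" "is_flag n F2"
    "flag_cone n F1 \<inter> lattice_points n = flag_cone n F2 \<inter> lattice_points n"
  shows "F1 = F2"
proof -
  have "\<exists>R. F1 = F2 @ R" by (rule flag_append_if_cone_subset[OF assms(1,2)]) (use assms(3) in blast)
  moreover have "\<exists>S. F2 = F1 @ S" by (rule flag_append_if_cone_subset[OF assms(2,1)]) (use assms(3) in blast)
  ultimately show ?thesis by force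
qed

section \<open>Dimensions and existence of flags\<close>

lemma dim_kernel_less:
  assumes V: "V \<subseteq> ambient n" "subspace V" and \<phi>: "linear \<phi>" "\<exists>x\<in>V. \<phi> x \<noteq> (0::real)"
    and W: "W \<subseteq> {x \<in> V. \<phi> x = 0}"
  shows "dim W < dim V"
proof -
  obtain B where B: "B \<subseteq> W" "independent B" "W \<subseteq> span B" "card B = dim W" using basis_exists by blast
  obtain C where C: "C \<subseteq> V" "independent C" "V \<subseteq> span C" "card C = dim V" using basis_exists by blast
  have fin: "finite C" using C V by (intro independent_in_ambient_finite[of C n]) auto
  obtain x where x: "x \<in> V" "\<phi> x \<noteq> 0" using \<phi>(2) by blast
  have zero: "\<phi> y = 0" if "y \<in> span B" for y
    using linear_eq_on_span[OF \<phi>(1) linear_zero, of B y] that B(1) W by auto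
  have "x \<notin> span B" using zero[of x] x(2) by blast
  then have ind: "independent (insert x B)" "x \<notin> B" using B(2) by (auto simp: independent_insert span_base)
  have "insert x B \<subseteq> span C" using x B(1) W C(3) by auto
  from independent_span_bound[OF fin ind(1) this] have "card (insert x B) \<le> card C" "finite B" by auto
  then show ?thesis using ind(2) B(4) C(4) by simp
qed

lemma dim_extend_less:
  assumes "is_flag n F" "linear \<phi>" "\<exists>x\<in>rational_part n F. \<phi> x \<noteq> 0"
  shows "dim (rational_part n (extend_flag n F \<phi>)) < dim (rational_part n F)"
proof (rule dim_kernel_less[OF rational_part_subset _ assms(2,3)])
  show "subspace (rational_part n F)" by (simp add: rational_part_def)
  show "rational_part n (extend_flag n F \<phi>) \<subseteq> {x \<in> rational_part n F. \<phi> x = 0}"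
    unfolding rational_part_def[of n "extend_flag n F \<phi>"] last_space_extend
    by (intro span_minimal) (auto simp: rational_part_def subspace_kernel[OF assms(2)])
qed

text \<open>
  A kernel has smaller dimension, and taking the span of its lattice points does not increase it again.
\<close>
lemma flag_extension_bound:
  "is_flag n (F @ R) \<Longrightarrow> length R + dim (rational_part n (F @ R)) \<le> dim (rational_part n F)"
proof (induction R rule: rev_induct)
  case (snoc x R)
  then have "is_flag n ((F @ R) @ [x])" by simp
  then obtain \<phi> where \<phi>: "is_flag n (F @ R)" "linear \<phi>" "\<exists>x\<in>rational_part n (F @ R). \<phi> x \<noteq> 0"
    "(F @ R) @ [x] = extend_flag n (F @ R) \<phi>"
    by (rule is_flag_snocE)
  have "dim (rational_part n (F @ R @ [x])) < dim (rational_part n (F @ R))"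
    using dim_extend_less[OF \<phi>(1-3)] \<phi>(4) by simp
  with snoc.IH[OF \<phi>(1)] show ?case by simp
qed simp

text \<open>
  Keep extending a flag whose open half-spaces have all their lattice points in \<open>K\<close> and whose cone contains
  \<open>K\<close>. As long as \<open>K\<close> does not contain all lattice points of the last space, a supporting functional of the
  part of \<open>K\<close> in it gives the next step, and totality forces the points where it is positive into \<open>K\<close>.
  The dimension decreases, so this ends.
\<close>
lemma flag_of_total_cone:
  assumes K: "total_cone (lattice_points n) K" and ray: "{0..} \<times> {0} \<subseteq> K"
  shows "\<exists>F. is_flag n F \<and> flag_cone n F \<inter> lattice_points n = K"
proof -
  have "\<exists>F'. is_flag n F' \<and> flag_cone n F' \<inter> lattice_points n = K"
    if "is_flag n F" "pos_part F \<inter> lattice_points n \<subseteq> K" "K \<subseteq> flag_cone n F" for F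
    using that
  proof (induction "dim (rational_part n F)" arbitrary: F rule: less_induct)
    case less
    let ?H = "last_space n F"
    have KL: "K \<subseteq> lattice_points n" using total_coneD(1)[OF K] .
    show ?case
    proof (cases "K \<inter> ?H = ?H \<inter> lattice_points n")
      case True
      then have "flag_cone n F \<inter> lattice_points n = K"
        using less.prems KL by (auto simp: flag_cone_eq)
      with less.prems(1) show ?thesis by blast
    next
      case False
      note H = flag_subspace[OF less.prems(1)]
      have cone: "total_cone (?H \<inter> lattice_points n) (K \<inter> ?H)"
        using K subspace_add[OF H] subspace_neg[OF H] unfolding total_cone_def by blast
      have "(r, 0) \<in> K \<inter> ?H" if "0 \<le> r" "(r, 0) \<in> ?H" for r using that ray by auto
      then obtain \<phi> :: "rvec \<Rightarrow> real" where \<phi>: "linear \<phi>" "\<exists>x\<in>?H \<inter> lattice_points n. \<phi> x \<noteq> 0"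
        "\<And>x. x \<in> K \<inter> ?H \<Longrightarrow> 0 \<le> \<phi> x"
        using supporting_functional[OF H cone _ False] by blast
      have nz: "\<exists>x\<in>rational_part n F. \<phi> x \<noteq> 0" using \<phi>(2) rational_part_lattice by blast
      let ?F = "extend_flag n F \<phi>"
      have "is_flag n ?F"
      proof (rule is_flag_extend[OF less.prems(1) \<phi>(1) nz])
        fix r :: real assume "0 \<le> r" "(r, 0) \<in> rational_part n F"
        then show "0 \<le> \<phi> (r, 0)" using ray flag_rational_part[OF less.prems(1)] by (intro \<phi>(3)) auto
      qed
      moreover have "pos_part ?F \<inter> lattice_points n \<subseteq> K"
      proof
        fix x assume x: "x \<in> pos_part ?F \<inter> lattice_points n"
        show "x \<in> K"
        proof (rule ccontr)
          assume nK: "x \<notin> K"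
          then have "x \<in> rational_part n F" "0 < \<phi> x" using x less.prems(2) by auto
          moreover have "- x \<in> K" using nK x total_coneD(3)[OF K, of x] by auto
          ultimately have "- x \<in> K \<inter> ?H" using flag_rational_part[OF less.prems(1)] subspace_neg[OF H] by blast
          from \<phi>(3)[OF this] \<open>0 < \<phi> x\<close> show False by (simp add: linear_neg[OF \<phi>(1)])
        qed
      qed
      moreover have "K \<subseteq> flag_cone n ?F"
      proof
        fix x assume x: "x \<in> K"
        show "x \<in> flag_cone n ?F"
        proof (cases "x \<in> pos_part F")
          case False
          then have "x \<in> ?H" using x less.prems(3) by (auto simp: flag_cone_eq)
          then have "x \<in> rational_part n F" "0 \<le> \<phi> x" using x KL rational_part_lattice[of x n F] \<phi>(3)[of x] by auto
          then show ?thesis by (auto simp: flag_cone_eq)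
        qed (simp add: flag_cone_eq)
      qed
      moreover have "dim (rational_part n ?F) < dim (rational_part n F)"
        by (rule dim_extend_less[OF less.prems(1) \<phi>(1) nz])
      ultimately show ?thesis using less.hyps by blast
    qed
  qed
  from this[OF is_flag_Nil] show ?thesis
    using total_coneD(1)[OF K] lattice_points_subset by (auto simp: flag_cone_eq)
qed

text \<open>
  Take a basis consisting of lattice points and a coordinate function of it: its kernel is again spanned by
  lattice points, so only one dimension is lost. Its sign is chosen to respect the order of the scalars.
\<close>
lemma flag_extend_once:
  assumes F: "is_flag n F" and pos: "0 < dim (rational_part n F)"
  shows "\<exists>\<phi>. is_flag n (extend_flag n F \<phi>) \<and>
    dim (rational_part n F) \<le> Suc (dim (rational_part n (extend_flag n F \<phi>)))"
proof -
  let ?L = "last_space n F \<inter> lattice_points n"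
  obtain B where B: "B \<subseteq> ?L" "independent B" "?L \<subseteq> span B" "card B = dim ?L" using basis_exists by blast
  have dim: "dim (rational_part n F) = card B" using B(4) by (simp add: rational_part_def)
  have fin: "finite B" using pos dim card_ge_0_finite by metis
  have "B \<noteq> {}" using pos dim by auto
  then obtain b where b: "b \<in> B" by blast
  obtain \<phi>0 :: "rvec \<Rightarrow> real" where \<phi>0: "linear \<phi>0" "\<forall>x\<in>B. \<phi>0 x = (if x = b then 1 else 0)"
    using linear_independent_extend[OF B(2), of "\<lambda>x. if x = b then 1 else 0"] by blast
  define \<phi> where "\<phi> x = (if 0 \<le> \<phi>0 (1, 0) then \<phi>0 x else - \<phi>0 x)" for x
  have lin: "linear \<phi>"
    unfolding \<phi>_def by (cases "0 \<le> \<phi>0 (1, 0)") (simp_all add: \<phi>0(1) linear_compose_neg)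
  have ray: "0 \<le> \<phi> (r, 0)" if "0 \<le> r" for r
  proof -
    have "\<phi> (r, 0) = r * \<phi> (1, 0)" using linear_scale[OF lin, of r "(1, 0)"] by simp
    moreover have "0 \<le> \<phi> (1, 0)" by (simp add: \<phi>_def)
    ultimately show ?thesis using that by simp
  qed
  have B_rat: "x \<in> rational_part n F" if "x \<in> B" for x using that B(1) by (auto simp: rational_part_def intro: span_base)
  have "\<phi> b \<noteq> 0" using \<phi>0(2) b by (simp add: \<phi>_def)
  then have "is_flag n (extend_flag n F \<phi>)" using F lin ray B_rat[OF b] by (intro is_flag_extend) auto
  moreover have "card (B - {b}) \<le> dim (rational_part n (extend_flag n F \<phi>))"
  proof -
    let ?W = "rational_part n (extend_flag n F \<phi>)"
    obtain C where C: "C \<subseteq> ?W" "independent C" "?W \<subseteq> span C" "card C = dim ?W" using basis_exists by blast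
    have "finite C" using C(1,2) rational_part_subset independent_in_ambient_finite by blast
    moreover have "independent (B - {b})" using B(2) independent_mono by blast
    moreover have "B - {b} \<subseteq> ?W"
    proof
      fix x assume "x \<in> B - {b}"
      then have "\<phi> x = 0" "x \<in> rational_part n F" "x \<in> lattice_points n"
        using \<phi>0(2) B(1) B_rat by (auto simp: \<phi>_def)
      then show "x \<in> ?W" by (intro rational_part_lattice) auto
    qed
    ultimately show ?thesis using independent_span_bound[of C "B - {b}"] C(3,4) by auto
  qed
  then have "dim (rational_part n F) \<le> Suc (dim (rational_part n (extend_flag n F \<phi>)))"
    using dim fin b by simp
  ultimately show ?thesis by blast
qed

lemma flag_maximal_extension:
  assumes "is_flag n F"
  shows "\<exists>R. is_flag n (F @ R) \<and> length R = dim (rational_part n F)"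
  using assms
proof (induction "dim (rational_part n F)" arbitrary: F)
  case 0
  then show ?case by (intro exI[of _ "[]"]) simp
next
  case (Suc d)
  then obtain \<phi> where \<phi>: "is_flag n (extend_flag n F \<phi>)"
    "dim (rational_part n F) \<le> Suc (dim (rational_part n (extend_flag n F \<phi>)))"
    using flag_extend_once[of n F] by auto
  obtain x where x: "extend_flag n F \<phi> = F @ [x]" by (auto simp: extend_flag_def)
  have "d = dim (rational_part n (F @ [x]))"
    using \<phi> Suc(2) flag_extension_bound[of n F "[x]"] x by simp
  from Suc(1)[OF this] \<phi>(1) x obtain R where "is_flag n ((F @ [x]) @ R)" "length R = d"
    using \<open>d = _\<close> by auto
  then show ?case using Suc(2) by (intro exI[of _ "x # R"]) simp
qed

section \<open>Prime congruences and their flags\<close>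

lemma embed_exponents: "embed ` (UNIV \<times> exponents n) = lattice_points n"
  by (simp add: lattice_points_def)

lemma embed_zero: "embed (r, 0) = (r, 0)"
  by (simp add: embed_def poly_mapping_eq_iff fun_eq_iff)

lemma total_cone_embed_iff:
  "total_cone (lattice_points n) (embed ` K) \<longleftrightarrow> total_cone (UNIV \<times> exponents n) K"
proof -
  have mem: "embed x \<in> embed ` A \<longleftrightarrow> x \<in> A" for x A
    using inj_image_mem_iff[OF inj_embed] .
  have "embed ` K \<subseteq> lattice_points n \<longleftrightarrow> K \<subseteq> UNIV \<times> exponents n"
    unfolding embed_exponents[symmetric] by (rule inj_image_subset_iff[OF inj_embed])
  moreover have "(\<forall>x\<in>embed ` K. \<forall>y\<in>embed ` K. x + y \<in> embed ` K) \<longleftrightarrow> (\<forall>x\<in>K. \<forall>y\<in>K. x + y \<in> K)"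
    by (simp add: mem flip: embed_add)
  moreover have "(\<forall>x\<in>lattice_points n. x \<in> embed ` K \<or> - x \<in> embed ` K)
      \<longleftrightarrow> (\<forall>x\<in>UNIV \<times> exponents n. x \<in> K \<or> - x \<in> K)"
    unfolding embed_exponents[symmetric] ball_simps(9) by (simp add: mem flip: embed_minus)
  ultimately show ?thesis by (simp add: total_cone_def)
qed

lemma ray_subset_iff: "{0..} \<times> {0} \<subseteq> A \<longleftrightarrow> (\<forall>r\<ge>0. (r, 0) \<in> A)"
  for A :: "(real \<times> 'a::zero) set"
  by auto

lemma ray_embed_iff: "{0..} \<times> {0} \<subseteq> embed ` K \<longleftrightarrow> {0..} \<times> {0} \<subseteq> K"
proof -
  have "(r, 0) \<in> embed ` K \<longleftrightarrow> (r, 0) \<in> K" for r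
    using inj_image_mem_iff[OF inj_embed, of "(r, 0)" K] by (simp add: embed_zero)
  then show ?thesis by (simp add: ray_subset_iff)
qed

lemma flag_of_prime:
  assumes P: "prime_congruence (laurent n) P"
  shows "is_flag n (flag_of n P)"
    and "embed ` cone_of_congruence n P = flag_cone n (flag_of n P) \<inter> lattice_points n"
proof -
  interpret prime_laurent_congruence n P by unfold_locales (rule P)
  let ?K = "embed ` cone_of_congruence n P"
  have "total_cone (lattice_points n) ?K" "{0..} \<times> {0} \<subseteq> ?K"
    using monomial_cone_of_congruence unfolding monomial_cone_def total_cone_embed_iff ray_embed_iff by auto
  then obtain F where F: "is_flag n F" "flag_cone n F \<inter> lattice_points n = ?K"
    using flag_of_total_cone by blast
  have "\<exists>!F. is_flag n F \<and> ?K = flag_cone n F \<inter> lattice_points n"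
    using F flag_cone_inj by (intro ex1I[of _ F]) auto
  from theI'[OF this] show "is_flag n (flag_of n P)" "?K = flag_cone n (flag_of n P) \<inter> lattice_points n"
    unfolding flag_of_def cone_of_congruence_def by auto
qed

text \<open>
  The cone of the flag is the positive cone of a total preorder, so it comes from a prime congruence.
\<close>
lemma prime_of_flag:
  assumes F: "is_flag n F"
  obtains P where "prime_congruence (laurent n) P" "flag_of n P = F"
proof -
  define K where "K = {x \<in> UNIV \<times> exponents n. embed x \<in> flag_cone n F}"
  have K: "embed ` K = flag_cone n F \<inter> lattice_points n"
    unfolding K_def embed_exponents[symmetric] by auto
  have "{0..} \<times> {0} \<subseteq> embed ` K"
    unfolding K using F by (auto simp: is_flag_iff)
  then have "monomial_cone n K"
    using total_flag_cone[OF F] unfolding monomial_cone_def K[symmetric] total_cone_embed_iff ray_embed_iff by simp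
  note P = prime_congruence_of_cone[OF this] and cone = cone_of_congruence_of_cone[OF this]
  have "flag_of n (congruence_of_cone n K) = F"
    using flag_of_prime[OF P] F K cone by (intro flag_cone_inj) auto
  with P show ?thesis by (rule that)
qed

text \<open>
  Inclusion of congruences is inclusion of their cones, and this is the initial segment relation of flags.
\<close>
lemma prime_subset_iff:
  assumes P: "prime_congruence (laurent n) P" "prime_congruence (laurent n) Q"
  shows "P \<subseteq> Q \<longleftrightarrow> (\<exists>R. flag_of n P = flag_of n Q @ R)"
proof
  interpret P: prime_laurent_congruence n P by unfold_locales (rule P(1))
  interpret Q: prime_laurent_congruence n Q by unfold_locales (rule P(2))
  note flagP = flag_of_prime[OF P(1)] and flagQ = flag_of_prime[OF P(2)]
  show "\<exists>R. flag_of n P = flag_of n Q @ R" if "P \<subseteq> Q"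
  proof (rule flag_append_if_cone_subset[OF flagP(1) flagQ(1)])
    have "cone_of_congruence n P \<subseteq> cone_of_congruence n Q" using that by (auto simp: cone_of_congruence_def)
    then show "flag_cone n (flag_of n P) \<inter> lattice_points n \<subseteq> flag_cone n (flag_of n Q)"
      using flagP(2) flagQ(2) by blast
  qed
  show "P \<subseteq> Q" if "\<exists>R. flag_of n P = flag_of n Q @ R"
  proof -
    have "flag_cone n (flag_of n P) \<subseteq> flag_cone n (flag_of n Q)"
      using that is_flag_appendD flagP(1) by metis
    then have "embed ` cone_of_congruence n P \<subseteq> embed ` cone_of_congruence n Q"
      unfolding flagP(2) flagQ(2) by blast
    then have "cone_of_congruence n P \<subseteq> cone_of_congruence n Q"
      using inj_image_subset_iff[OF inj_embed] by blast
    from congruence_of_cone_mono[OF P.monomial_cone_of_congruence Q.monomial_cone_of_congruence this]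
    show ?thesis by (simp add: P.congruence_of_cone_of_congruence Q.congruence_of_cone_of_congruence)
  qed
qed

lemma prime_psubset_iff:
  assumes P: "prime_congruence (laurent n) P" "prime_congruence (laurent n) Q"
  shows "P \<subset> Q \<longleftrightarrow> (\<exists>R. R \<noteq> [] \<and> flag_of n P = flag_of n Q @ R)"
proof -
  have "Q \<subseteq> P \<longleftrightarrow> (\<exists>R. flag_of n Q = flag_of n P @ R)" using prime_subset_iff[OF P(2,1)] .
  then show ?thesis using prime_subset_iff[OF P] by (auto simp: psubset_eq)
qed

section \<open>Chains of prime congruences\<close>

lemma prime_chain_flags:
  assumes c: "prime_chain (laurent n) l c" and "i \<le> l"
  shows "\<exists>R. flag_of n (c 0) = flag_of n (c i) @ R \<and> i \<le> length R"
  using assms(2)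
proof (induction i)
  case (Suc i)
  then obtain R where R: "flag_of n (c 0) = flag_of n (c i) @ R" "i \<le> length R" by auto
  have "prime_congruence (laurent n) (c i)" "prime_congruence (laurent n) (c (Suc i))" "c i \<subset> c (Suc i)"
    using c Suc.prems by (auto simp: prime_chain_def)
  then obtain S where "S \<noteq> []" "flag_of n (c i) = flag_of n (c (Suc i)) @ S"
    using prime_psubset_iff by blast
  with R show ?case by (intro exI[of _ "S @ R"]) (cases S; auto)
qed simp

text \<open>
  This one construction serves both dimensions: for the coheight \<open>F\<close> is the flag of the congruence where
  the chain starts, for the height it is a maximal extension of the flag of the congruence where it ends.
\<close>
lemma chain_of_truncations:
  assumes F: "is_flag n F" and l: "l \<le> length F"
  obtains c where "prime_chain (laurent n) l c" "\<And>i. i \<le> l \<Longrightarrow> flag_of n (c i) = take (length F - i) F"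
proof -
  have "is_flag n (take j F)" for j using is_flag_appendD[of n "take j F" "drop j F"] F by simp
  then have "\<forall>i. \<exists>P. prime_congruence (laurent n) P \<and> flag_of n P = take (length F - i) F"
    using prime_of_flag by metis
  then obtain c where c: "\<And>i. prime_congruence (laurent n) (c i)" "\<And>i. flag_of n (c i) = take (length F - i) F"
    by metis
  have "c i \<subset> c (Suc i)" if "i < l" for i
  proof -
    have *: "length F - i = Suc (length F - Suc i)" using that l by simp
    have "flag_of n (c i) = flag_of n (c (Suc i)) @ [F ! (length F - Suc i)]"
      unfolding c(2) * using that l by (intro take_Suc_conv_app_nth) simp
    then show ?thesis using prime_psubset_iff[OF c(1) c(1)] by blast
  qed
  then show ?thesis using c by (intro that[of c]) (auto simp: prime_chain_def)
qed

lemma flag_of_inj: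
  assumes "prime_congruence (laurent n) P" "prime_congruence (laurent n) Q" "flag_of n P = flag_of n Q"
  shows "P = Q"
  using prime_subset_iff[OF assms(1,2)] prime_subset_iff[OF assms(2,1)] assms(3) by auto

lemma coheight_flag:
  assumes P: "prime_congruence (laurent n) P"
  shows "coheight (laurent n) P = enat (length (flag_of n P))"
  unfolding coheight_def
proof (rule antisym)
  show "Sup {enat l |l. \<exists>c. prime_chain (laurent n) l c \<and> c 0 = P} \<le> enat (length (flag_of n P))"
  proof (rule Sup_least, clarify)
    fix l c assume c: "prime_chain (laurent n) l c" "P = c 0"
    then show "enat l \<le> enat (length (flag_of n (c 0)))"
      using prime_chain_flags[OF c(1), of l] by auto
  qed
  obtain c where c: "prime_chain (laurent n) (length (flag_of n P)) c"
    "\<And>i. i \<le> length (flag_of n P) \<Longrightarrow> flag_of n (c i) = take (length (flag_of n P) - i) (flag_of n P)"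
    using chain_of_truncations[OF flag_of_prime(1)[OF P] order_refl] by blast
  have "c 0 = P" using c P by (intro flag_of_inj[of n]) (auto simp: prime_chain_def)
  with c(1) show "enat (length (flag_of n P)) \<le> Sup {enat l |l. \<exists>c. prime_chain (laurent n) l c \<and> c 0 = P}"
    by (intro Sup_upper) blast
qed

lemma height_flag:
  assumes P: "prime_congruence (laurent n) P"
  shows "height (laurent n) P = enat (dim (rational_part n (flag_of n P)))"
  unfolding height_def
proof (rule antisym)
  let ?F = "flag_of n P"
  let ?d = "dim (rational_part n ?F)"
  show "Sup {enat l |l. \<exists>c. prime_chain (laurent n) l c \<and> c l = P} \<le> enat ?d"
  proof (rule Sup_least, clarify)
    fix l c assume c: "prime_chain (laurent n) l c" "P = c l"
    obtain R where R: "flag_of n (c 0) = flag_of n (c l) @ R" "l \<le> length R"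
      using prime_chain_flags[OF c(1), of l] by auto
    have "is_flag n (flag_of n (c 0))" using c(1) by (intro flag_of_prime(1)) (simp add: prime_chain_def)
    then show "enat l \<le> enat (dim (rational_part n (flag_of n (c l))))"
      using flag_extension_bound[of n "flag_of n (c l)" R] R by simp
  qed
  obtain R where R: "is_flag n (?F @ R)" "length R = ?d"
    using flag_maximal_extension[OF flag_of_prime(1)[OF P]] by blast
  obtain c where c: "prime_chain (laurent n) ?d c"
    "\<And>i. i \<le> ?d \<Longrightarrow> flag_of n (c i) = take (length (?F @ R) - i) (?F @ R)"
    by (rule chain_of_truncations[OF R(1), of ?d]) (use R(2) in auto)
  have "c ?d = P" using c P R(2) by (intro flag_of_inj[of n]) (auto simp: prime_chain_def)
  with c(1) show "enat ?d \<le> Sup {enat l |l. \<exists>c. prime_chain (laurent n) l c \<and> c l = P}"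
    by (intro Sup_upper) blast
qed

lemma truncation_iff: "is_flag n F' \<Longrightarrow> truncation n F' F \<longleftrightarrow> (\<exists>R. F = F' @ R)"
proof -
  assume "is_flag n F'"
  moreover have "(\<exists>l'\<le>length F. F' = take l' F) \<longleftrightarrow> (\<exists>R. F = F' @ R)"
    by (metis append_eq_conv_conj append_take_drop_id length_append le_add1)
  ultimately show ?thesis by (simp add: truncation_def)
qed

theorem proposition5p12:
  fixes n :: nat
  shows "(\<forall>P1 P2. prime_congruence (laurent n) P1 \<longrightarrow> prime_congruence (laurent n) P2 \<longrightarrow>
            (P1 \<subseteq> P2 \<longleftrightarrow> truncation n (flag_of n P2) (flag_of n P1))) \<and>
         (\<forall>P l. prime_congruence (laurent n) P \<longrightarrow> length (flag_of n P) = l \<longrightarrow>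
            height (laurent n) P
              = enat (dim (span (flag_space n (flag_of n P) l \<inter> lattice_points n))) \<and>
            coheight (laurent n) P = enat l)"
  by (auto simp: truncation_iff flag_of_prime(1) prime_subset_iff height_flag coheight_flag
      rational_part_def last_space_def)

end
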